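(* Let $S$ be a finitely generated positive cancelative commutative semigroup, $E\subset S\setminus\{0\}$ a nonempty finite subset which generates the cone $C(S)$, and $\mathbb{K}$ a field. Let $r$ be the depth of the semigroup algebra $\mathbb{K}[S]$. Let $r'$ be the integer defined by the two conditions $$D^J=\emptyset\ \text{ for all } J\subset E \text{ with } \#J\ge\#E-r'+2,$$ $$D^J\ne\emptyset\ \text{ for some } J\subset E\text{ with }\#J=\#E-r'+1,$$ with the convention $r'=\#E$ if $D^J=\emptyset$ for all $J\subset E$ with $\#J\ge2$. Then: (1) $r\ge r'$. (2) If for some $m\in S$ the complex $T_m$ has a $(\#E-r'-1)$-dimensional sphere, then $r'=r$. (3) If $D$ is a finite set, then $r'=r$.
   Context: Semigroups: a semigroup here is a set with an associative operation $+$ and a neutral element $0$. It is cancelative if $m+n=m'+n$ implies $m=m'$; positive if $m+n=0$ implies $m=n=0$; finitely generated if finitely many elements generate it under linear combinations with nonnegative integer coefficients. $S$ is viewed inside the abelian group $G(S)$ it generates (its group of differences); differences $m-n$ are taken in $G(S)$ (which may have torsion). $C(S)$ is the convex cone in $G(S)\otimes_{\mathbb{Z}}\mathbb{Q}$ generated by the elements $m\otimes1$, $m\in S$; "$E$ generates the cone $C(S)$" means that every element of $C(S)$ is a nonnegative rational combination of the elements $e\otimes1$, $e\in E$. Sets and complexes attached to $E$: for $J\subset E$ let $e_J=\sum_{e\in J}e$ (with $e_\emptyset=0$). For $m\in S$, $T_m=\{J\subset E\mid m-e_J\in S\}$, a simplicial complex containing the empty face, and $\mathrm{supp}(m)=\{e\in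 E\mid m-e\in S\}$. For $J\subset E$ with $\#J\ge2$, $D^J=\{m\in S\mid J\subset\mathrm{supp}(m)\text{ and }m-e_J\notin S\}$. The set $D=\{m\in S\mid m-e_{\mathrm{supp}(m)}\notin S\}$ is the union of the $D^J$, $J\subset E$, $\#J\ge2$. Depth: $\mathbb{K}[S]=\bigoplus_{m\in S}\mathbb{K}t^m$ is the semigroup algebra ($t^mt^n=t^{m+n}$), an $S$-graded module over the polynomial ring $R_E=\mathbb{K}[X_e,\ e\in E]$ via $X_e\mapsto t^e$; it is a finite $R_E$-module since $E$ generates $C(S)$. Its depth $r$ is the depth as an $R_E$-module with respect to the ideal $(X_e,\ e\in E)$ (it depends only on $\mathbb{K}[S]$). Equivalently (known fact), $r$ is the integer such that $\tilde h_{\#E-r}(T_m)=0$ for all $m\in S$ and $\tilde h_{\#E-r-1}(T_m)\ne0$ for some $m\in S$, where $\tilde h_i(T)=\dim_{\mathbb{K}}\tilde H_i(T;\mathbb{K})$ is the dimension of reduced simplicial homology (with $\tilde h_{-1}(\{\emptyset\})=1$). Spheres: for a simplicial complex $T$ of subsets of $E$ and $-1\le k\le\#E-2$, a $k$-dimensional sphere of $T$ is a subset $J\subset E$ with $J\notin T$, $\#J=k+2$, and $J\setminus\{e\}\in T$ for all $e\in J$. *)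

theory Defs
  imports "HOL-Library.Poly_Mapping" "HOL-Library.Extended_Nat"
begin

text \<open>
  A semigroup with neutral element is a type of class \<open>comm_monoid_add\<close>. Cancellation is stated
  as an explicit property, since the library class \<open>cancel_comm_monoid_add\<close> also requires
  a total subtraction on the semigroup itself.
\<close>

definition cancelative :: "'s::comm_monoid_add itself \<Rightarrow> bool" where
  "cancelative _ \<longleftrightarrow> (\<forall>m m' n :: 's. m + n = m' + n \<longrightarrow> m = m')"

definition positive :: "'s::comm_monoid_add itself \<Rightarrow> bool" where
  "positive _ \<longleftrightarrow> (\<forall>m n :: 's. m + n = 0 \<longrightarrow> m = 0 \<and> n = 0)"

definition nat_scale :: "nat \<Rightarrow> 's::comm_monoid_add \<Rightarrow> 's" where
  "nat_scale k s = (\<Sum>i<k. s)"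

definition finitely_generated :: "'s::comm_monoid_add itself \<Rightarrow> bool" where
  "finitely_generated _ \<longleftrightarrow>
     (\<exists>A :: 's set. finite A \<and> (\<forall>s. \<exists>c :: 's \<Rightarrow> nat. s = (\<Sum>a\<in>A. nat_scale (c a) a)))"


section \<open>The group of differences\<close>

text \<open>The pair \<open>(a, b)\<close> represents \<open>a - b\<close>; the summand \<open>k\<close> makes the relation transitive
  also when the semigroup is not cancelative.\<close>

definition diff_rel :: "'s::comm_monoid_add \<times> 's \<Rightarrow> 's \<times> 's \<Rightarrow> bool" where
  "diff_rel x y \<longleftrightarrow> (\<exists>k. fst x + snd y + k = fst y + snd x + k)"

lemma equivp_diff_rel: "equivp (diff_rel :: 's::comm_monoid_add \<times> 's \<Rightarrow> _)"
proof (rule equivpI)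
  show "reflp (diff_rel :: 's \<times> 's \<Rightarrow> _)"
    by (auto simp: reflp_def diff_rel_def)
  show "symp (diff_rel :: 's \<times> 's \<Rightarrow> _)"
    by (auto simp: symp_def diff_rel_def) metis
  show "transp (diff_rel :: 's \<times> 's \<Rightarrow> _)"
  proof (rule transpI)
    fix x y z :: "'s \<times> 's"
    assume "diff_rel x y" "diff_rel y z"
    then obtain k l where
      k: "fst x + snd y + k = fst y + snd x + k" and
      l: "fst y + snd z + l = fst z + snd y + l"
      by (auto simp: diff_rel_def)
    have "fst x + snd z + (snd y + k + l) = (fst x + snd y + k) + (snd z + l)"
      by (simp add: ac_simps)
    also have "\<dots> = (fst y + snd z + l) + (snd x + k)"
      unfolding k by (simp add: ac_simps)
    also have "\<dots> = fst z + snd x + (snd y + k + l)"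
      unfolding l by (simp add: ac_simps)
    finally show "diff_rel x z"
      unfolding diff_rel_def by blast
  qed
qed

quotient_type (overloaded) 's diff_group = "'s::comm_monoid_add \<times> 's" / diff_rel
  by (rule equivp_diff_rel)

instantiation diff_group :: (comm_monoid_add) ab_group_add
begin

lift_definition zero_diff_group :: "'a diff_group" is "(0, 0)" .

lift_definition plus_diff_group :: "'a diff_group \<Rightarrow> 'a diff_group \<Rightarrow> 'a diff_group"
  is "\<lambda>x y. (fst x + fst y, snd x + snd y)"
proof -
  fix x x' y y' :: "'a \<times> 'a"
  assume "diff_rel x x'" "diff_rel y y'"
  then obtain k l where
    k: "fst x + snd x' + k = fst x' + snd x + k" and
    l: "fst y + snd y' + l = fst y' + snd y + l"
    by (auto simp: diff_rel_def)
  have "fst x + fst y + (snd x' + snd y') + (k + l)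
      = (fst x + snd x' + k) + (fst y + snd y' + l)"
    by (simp add: ac_simps)
  also have "\<dots> = fst x' + fst y' + (snd x + snd y) + (k + l)"
    unfolding k l by (simp add: ac_simps)
  finally show "diff_rel (fst x + fst y, snd x + snd y) (fst x' + fst y', snd x' + snd y')"
    unfolding diff_rel_def by auto
qed

lift_definition uminus_diff_group :: "'a diff_group \<Rightarrow> 'a diff_group"
  is "\<lambda>x. (snd x, fst x)"
  by (auto simp: diff_rel_def) (metis add.commute)

definition minus_diff_group :: "'a diff_group \<Rightarrow> 'a diff_group \<Rightarrow> 'a diff_group" where
  "minus_diff_group x y = x + - y"

instance
proof
  fix a b c :: "'a diff_group"
  show "a + b + c = a + (b + c)"
    by transfer (simp add: diff_rel_def ac_simps)
  show "a + b = b + a"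
    by transfer (simp add: diff_rel_def ac_simps)
  show "0 + a = a"
    by transfer (simp add: diff_rel_def)
  show "- a + a = 0"
    by transfer (simp add: diff_rel_def ac_simps)
  show "a - b = a + - b"
    by (rule minus_diff_group_def)
qed

end

lift_definition to_group :: "'s::comm_monoid_add \<Rightarrow> 's diff_group" is "\<lambda>m. (m, 0)" .

lemma to_group_add: "to_group (m + n) = to_group m + to_group n"
  by transfer (simp add: diff_rel_def)

lemma to_group_inject:
  assumes "cancelative TYPE('s::comm_monoid_add)"
  shows "to_group (m :: 's) = to_group n \<longleftrightarrow> m = n"
  using assms unfolding cancelative_def by transfer (auto simp: diff_rel_def)

definition in_semigroup :: "'s::comm_monoid_add diff_group \<Rightarrow> bool" where
  "in_semigroup g \<longleftrightarrow> g \<in> range to_group"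


section \<open>Tensoring an abelian group with the rationals\<close>

text \<open>The tensor product over the integers, as the free abelian group on pairs
  modulo the subgroup generated by the biadditivity relations.\<close>

inductive_set biadditive_relations :: "(('g::ab_group_add \<times> rat) \<Rightarrow>\<^sub>0 int) set" where
  zero: "0 \<in> biadditive_relations"
| left: "frag_of (g + h, q) - frag_of (g, q) - frag_of (h, q) \<in> biadditive_relations"
| right: "frag_of (g, p + q) - frag_of (g, p) - frag_of (g, q) \<in> biadditive_relations"
| diff: "x \<in> biadditive_relations \<Longrightarrow> y \<in> biadditive_relations \<Longrightarrow> x - y \<in> biadditive_relations"

lemma biadditive_relations_uminus:
  "x \<in> biadditive_relations \<Longrightarrow> - x \<in> biadditive_relations"
  using biadditive_relations.diff[OF biadditive_relations.zero] by fastforce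

lemma biadditive_relations_add:
  "x \<in> biadditive_relations \<Longrightarrow> y \<in> biadditive_relations \<Longrightarrow> x + y \<in> biadditive_relations"
  using biadditive_relations.diff[OF _ biadditive_relations_uminus, of x y] by simp

definition tensor_rel ::
  "(('g::ab_group_add \<times> rat) \<Rightarrow>\<^sub>0 int) \<Rightarrow> (('g \<times> rat) \<Rightarrow>\<^sub>0 int) \<Rightarrow> bool" where
  "tensor_rel x y \<longleftrightarrow> x - y \<in> biadditive_relations"

lemma equivp_tensor_rel: "equivp (tensor_rel :: (('g::ab_group_add \<times> rat) \<Rightarrow>\<^sub>0 int) \<Rightarrow> _)"
proof (rule equivpI)
  show "reflp (tensor_rel :: (('g \<times> rat) \<Rightarrow>\<^sub>0 int) \<Rightarrow> _)"
    by (auto simp: reflp_def tensor_rel_def intro: biadditive_relations.zero)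
  show "symp (tensor_rel :: (('g \<times> rat) \<Rightarrow>\<^sub>0 int) \<Rightarrow> _)"
    unfolding symp_def tensor_rel_def using biadditive_relations_uminus by fastforce
  show "transp (tensor_rel :: (('g \<times> rat) \<Rightarrow>\<^sub>0 int) \<Rightarrow> _)"
    unfolding transp_def tensor_rel_def using biadditive_relations_add by fastforce
qed

quotient_type (overloaded) 'g tensor_rat = "('g::ab_group_add \<times> rat) \<Rightarrow>\<^sub>0 int" / tensor_rel
  by (rule equivp_tensor_rel)

instantiation tensor_rat :: (ab_group_add) ab_group_add
begin

lift_definition zero_tensor_rat :: "'a tensor_rat" is 0 .

lift_definition plus_tensor_rat :: "'a tensor_rat \<Rightarrow> 'a tensor_rat \<Rightarrow> 'a tensor_rat" is "(+)"
  unfolding tensor_rel_def by (metis add_diff_add biadditive_relations_add)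

lift_definition uminus_tensor_rat :: "'a tensor_rat \<Rightarrow> 'a tensor_rat" is uminus
  unfolding tensor_rel_def using biadditive_relations_uminus by fastforce

definition minus_tensor_rat :: "'a tensor_rat \<Rightarrow> 'a tensor_rat \<Rightarrow> 'a tensor_rat" where
  "minus_tensor_rat x y = x + - y"

instance
proof
  fix a b c :: "'a tensor_rat"
  show "a + b + c = a + (b + c)"
    by transfer (simp add: tensor_rel_def biadditive_relations.zero add.assoc)
  show "a + b = b + a"
    by transfer (simp add: tensor_rel_def biadditive_relations.zero add.commute)
  show "0 + a = a"
    by transfer (simp add: tensor_rel_def biadditive_relations.zero)
  show "- a + a = 0"
    by transfer (simp add: tensor_rel_def biadditive_relations.zero)
  show "a - b = a + - b"
    by (rule minus_tensor_rat_def)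
qed

end

lift_definition tensor :: "'g::ab_group_add \<Rightarrow> rat \<Rightarrow> 'g tensor_rat" is "\<lambda>g q. frag_of (g, q)" .

lift_definition rat_scale :: "rat \<Rightarrow> 'g::ab_group_add tensor_rat \<Rightarrow> 'g tensor_rat"
  is "\<lambda>q. frag_extend (\<lambda>(g, p). frag_of (g, q * p))"
proof -
  fix q :: rat and x y :: "('g \<times> rat) \<Rightarrow>\<^sub>0 int"
  let ?s = "frag_extend (\<lambda>(g :: 'g, p). frag_of (g, q * p))"
  have "?s z \<in> biadditive_relations" if "z \<in> biadditive_relations" for z
    using that
  proof induction
    case zero
    show ?case by (simp add: biadditive_relations.zero)
  next
    case (left g h p)
    show ?case by (simp add: frag_extend_diff biadditive_relations.left)
  next
    case (right g p p')
    show ?case by (simp add: frag_extend_diff distrib_left biadditive_relations.right)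
  next
    case (diff x y)
    then show ?case by (simp add: frag_extend_diff biadditive_relations.diff)
  qed
  moreover assume "tensor_rel x y"
  ultimately show "tensor_rel (?s x) (?s y)"
    unfolding tensor_rel_def by (metis frag_extend_diff)
qed

lemma tensor_add_left: "tensor (g + h) q = tensor g q + tensor h q"
  by transfer (use biadditive_relations.left in \<open>simp add: tensor_rel_def diff_diff_eq\<close>)

lemma tensor_add_right: "tensor g (p + q) = tensor g p + tensor g q"
  by transfer (use biadditive_relations.right in \<open>simp add: tensor_rel_def diff_diff_eq\<close>)

lemma rat_scale_tensor: "rat_scale q (tensor g p) = tensor g (q * p)"
  by transfer (simp add: tensor_rel_def biadditive_relations.zero)

definition rat_cone :: "'g::ab_group_add tensor_rat set \<Rightarrow> 'g tensor_rat set" where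
  "rat_cone A = {\<Sum>x\<in>F. rat_scale (c x) x | F c. finite F \<and> F \<subseteq> A \<and> (\<forall>x\<in>F. 0 \<le> c x)}"

definition semigroup_cone :: "'s::comm_monoid_add diff_group tensor_rat set" where
  "semigroup_cone = rat_cone (range (\<lambda>m :: 's. tensor (to_group m) 1))"

definition generates_cone :: "'s::comm_monoid_add set \<Rightarrow> bool" where
  "generates_cone E \<longleftrightarrow> semigroup_cone \<subseteq> rat_cone ((\<lambda>e. tensor (to_group e) 1) ` E)"


section \<open>Sets and complexes attached to a finite subset of the semigroup\<close>

definition complex_of :: "'s::comm_monoid_add set \<Rightarrow> 's \<Rightarrow> 's set set" where
  "complex_of E m = {J. J \<subseteq> E \<and> in_semigroup (to_group m - to_group (\<Sum>J))}"

definition supp :: "'s::comm_monoid_add set \<Rightarrow> 's \<Rightarrow> 's set" where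
  "supp E m = {e \<in> E. in_semigroup (to_group m - to_group e)}"

definition D_face :: "'s::comm_monoid_add set \<Rightarrow> 's set \<Rightarrow> 's set" where
  "D_face E J = {m. J \<subseteq> supp E m \<and> \<not> in_semigroup (to_group m - to_group (\<Sum>J))}"

definition D_set :: "'s::comm_monoid_add set \<Rightarrow> 's set" where
  "D_set E = {m. \<not> in_semigroup (to_group m - to_group (\<Sum>(supp E m)))}"

definition is_sphere :: "'e set \<Rightarrow> 'e set set \<Rightarrow> int \<Rightarrow> 'e set \<Rightarrow> bool" where
  "is_sphere E T k J \<longleftrightarrow>
     - 1 \<le> k \<and> k \<le> int (card E) - 2 \<and>
     J \<subseteq> E \<and> J \<notin> T \<and> int (card J) = k + 2 \<and> (\<forall>e\<in>J. J - {e} \<in> T)"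

definition is_r_prime :: "'s::comm_monoid_add set \<Rightarrow> int \<Rightarrow> bool" where
  "is_r_prime E r' \<longleftrightarrow>
     (if \<forall>J\<subseteq>E. card J \<ge> 2 \<longrightarrow> D_face E J = {} then r' = int (card E)
      else (\<forall>J\<subseteq>E. card J \<ge> 2 \<longrightarrow> int (card J) \<ge> int (card E) - r' + 2 \<longrightarrow> D_face E J = {}) \<and>
           (\<exists>J\<subseteq>E. card J \<ge> 2 \<and> int (card J) = int (card E) - r' + 1 \<and> D_face E J \<noteq> {}))"

lemma is_r_prime_bounds:
  assumes "finite E" "E \<noteq> {}" "is_r_prime E r'"
  shows "1 \<le> r' \<and> r' \<le> int (card E)"
proof (cases "\<forall>J\<subseteq>E. card J \<ge> 2 \<longrightarrow> D_face E J = {}")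
  case True
  then have "r' = int (card E)"
    using assms(3) unfolding is_r_prime_def by (simp only: if_True simp_thms)
  moreover have "card E > 0"
    using assms(1,2) card_gt_0_iff by blast
  ultimately show ?thesis
    by linarith
next
  case False
  then have "\<exists>J\<subseteq>E. card J \<ge> 2 \<and> int (card J) = int (card E) - r' + 1 \<and> D_face E J \<noteq> {}"
    using assms(3) unfolding is_r_prime_def by (simp only: if_False simp_thms)
  then obtain J where "J \<subseteq> E" "card J \<ge> 2" "int (card J) = int (card E) - r' + 1"
    by blast
  moreover from this(1) have "card J \<le> card E"
    using assms(1) card_mono by blast
  ultimately show ?thesis
    by linarith
qed


section \<open>Regular sequences and depth\<close>

definition submodule_multiples ::
  "('r \<Rightarrow> 'm \<Rightarrow> 'm::ab_group_add) \<Rightarrow> 'r list \<Rightarrow> nat \<Rightarrow> 'm set" where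
  "submodule_multiples act fs i = {\<Sum>j<i. act (fs ! j) (g j) | g. True}"

text \<open>The module is the whole type \<open>'m\<close>: each \<open>fs ! i\<close> is a nonzerodivisor on the quotient
  by the submodule generated by the multiples of the previous terms, and the last
  quotient is nonzero.\<close>

definition regular_sequence :: "('r \<Rightarrow> 'm \<Rightarrow> 'm::ab_group_add) \<Rightarrow> 'r list \<Rightarrow> bool" where
  "regular_sequence act fs \<longleftrightarrow>
     (\<forall>i<length fs. \<forall>x. act (fs ! i) x \<in> submodule_multiples act fs i
         \<longrightarrow> x \<in> submodule_multiples act fs i) \<and>
     submodule_multiples act fs (length fs) \<noteq> UNIV"

definition depth :: "('r \<Rightarrow> 'm \<Rightarrow> 'm::ab_group_add) \<Rightarrow> 'r set \<Rightarrow> enat" where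
  "depth act I = (SUP fs \<in> {fs. set fs \<subseteq> I \<and> regular_sequence act fs}. enat (length fs))"


section \<open>The semigroup algebra as a module over the polynomial ring\<close>

text \<open>The semigroup algebra is \<open>'s \<Rightarrow>\<^sub>0 'k\<close> with the convolution product of the library;
  \<open>t^m\<close> is \<open>Poly_Mapping.single m 1\<close>. Polynomials are elements of \<open>('s \<Rightarrow>\<^sub>0 nat) \<Rightarrow>\<^sub>0 'k\<close>, with
  exponent vectors \<open>'s \<Rightarrow>\<^sub>0 nat\<close>; the variables are indexed by the elements of \<open>E\<close>.\<close>

definition poly_ring :: "'s set \<Rightarrow> (('s \<Rightarrow>\<^sub>0 nat) \<Rightarrow>\<^sub>0 'k::field) set" where
  "poly_ring E = {p. \<forall>\<alpha>\<in>Poly_Mapping.keys p. Poly_Mapping.keys \<alpha> \<subseteq> E}"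

definition Var :: "'s \<Rightarrow> ('s \<Rightarrow>\<^sub>0 nat) \<Rightarrow>\<^sub>0 'k::field" where
  "Var e = Poly_Mapping.single (Poly_Mapping.single e 1) 1"

definition variable_ideal :: "'s set \<Rightarrow> (('s \<Rightarrow>\<^sub>0 nat) \<Rightarrow>\<^sub>0 'k::field) set" where
  "variable_ideal E = {\<Sum>e\<in>E. Var e * h e | h. \<forall>e\<in>E. h e \<in> poly_ring E}"

definition exponent_value :: "('s \<Rightarrow>\<^sub>0 nat) \<Rightarrow> 's::comm_monoid_add" where
  "exponent_value \<alpha> = (\<Sum>e\<in>Poly_Mapping.keys \<alpha>. nat_scale (Poly_Mapping.lookup \<alpha> e) e)"

text \<open>The algebra homomorphism with \<open>X_e \<mapsto> t^e\<close>.\<close>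

definition to_semigroup_algebra ::
  "(('s::comm_monoid_add \<Rightarrow>\<^sub>0 nat) \<Rightarrow>\<^sub>0 'k::field) \<Rightarrow> ('s \<Rightarrow>\<^sub>0 'k)" where
  "to_semigroup_algebra p =
     (\<Sum>\<alpha>\<in>Poly_Mapping.keys p. Poly_Mapping.single (exponent_value \<alpha>) (Poly_Mapping.lookup p \<alpha>))"

lemma to_semigroup_algebra_Var:
  "to_semigroup_algebra (Var e) = Poly_Mapping.single e 1"
  by (simp add: to_semigroup_algebra_def Var_def exponent_value_def nat_scale_def)

definition poly_act ::
  "(('s::comm_monoid_add \<Rightarrow>\<^sub>0 nat) \<Rightarrow>\<^sub>0 'k::field) \<Rightarrow> ('s \<Rightarrow>\<^sub>0 'k) \<Rightarrow> ('s \<Rightarrow>\<^sub>0 'k)" where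
  "poly_act p x = to_semigroup_algebra p * x"

definition semigroup_algebra_depth :: "'k::field itself \<Rightarrow> 's::comm_monoid_add set \<Rightarrow> enat" where
  "semigroup_algebra_depth _ E =
     depth (poly_act :: (('s \<Rightarrow>\<^sub>0 nat) \<Rightarrow>\<^sub>0 'k) \<Rightarrow> _) (variable_ideal E)"

end

(*
  Each x_e acts null-homotopically on the Koszul complex of the elements t^e, so dividing by a
  regular element of the ideal they generate shifts non-vanishing Koszul homology up by exactly one
  degree. A regular element exists as long as the top homology vanishes: otherwise, by prime
  avoidance, the ideal lies in one of the finitely many maximal annihilators and so kills a nonzero
  element. Hence the depth is #E - i, where i is the largest index with non-vanishing homology of
  K[S]. In degree m the Koszul complex is the augmented chain complex of T_m. If all D^J with
  #J = i + 1 are empty, every face of size i of T_m can be joined to any vertex, and the cone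
  contracts T_m in that dimension; this gives r >= r'. Conversely a sphere J of size #E - r' + 1 >= 2
  is all of supp(m), since a larger support would have to be a face; so its boundary bounds nothing
  and r <= r'. If D is finite, an element of D^J with the most divisors in D^J makes J a sphere.
*)
theory Submission
  imports Defs
begin

section \<open>Noetherian subrings\<close>

text \<open>\<open>E\<close> generates only the cone, so the elements of \<open>K[S]\<close> through
  which the ideal of variables acts form a set closed under sums and products that need not be an
  ideal of \<open>K[S]\<close>. Prime avoidance is therefore proved for such sets, while the chain
  condition is that of \<open>K[S]\<close> itself and comes from the finitely many generators of
  \<open>S\<close>. The action goes through a ring homomorphism, so the submodules cut out by a
  sequence are ideals \<open>N\<close> of \<open>K[S]\<close>. No quotient is formed: cycles,
  boundaries and regularity modulo \<open>N\<close> are all expressed by membership in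
  \<open>N\<close>, and the complex stays fixed while \<open>N\<close> grows. Index 0 stands apart
  on both sides. A contracting cone needs a vertex, which a nonempty face provides and the empty
  face does not; the lower bound only involves indices above #E - r', which is nonnegative. For the
  upper bound at index 0 the missing face is a single vertex, and the homology is found in degree
  0.\<close>

definition subring :: "'a::comm_ring_1 set \<Rightarrow> bool" where
  "subring B \<longleftrightarrow> 1 \<in> B \<and> (\<forall>a\<in>B. \<forall>b\<in>B. a - b \<in> B \<and> a * b \<in> B)"

text \<open>Relative to a subring, because the basis theorem is applied along a growing chain of
  subrings of one fixed ring type, starting with the constants.\<close>

definition ideal_in :: "'a::comm_ring_1 set \<Rightarrow> 'a set \<Rightarrow> bool" where
  "ideal_in B I \<longleftrightarrow>
     I \<subseteq> B \<and> 0 \<in> I \<and> (\<forall>a\<in>I. \<forall>b\<in>I. a + b \<in> I) \<and> (\<forall>c\<in>B. \<forall>a\<in>I. c * a \<in> I)"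

abbreviation ideal :: "'a::comm_ring_1 set \<Rightarrow> bool" where
  "ideal \<equiv> ideal_in UNIV"

definition noetherian :: "'a::comm_ring_1 set \<Rightarrow> bool" where
  "noetherian B \<longleftrightarrow>
     (\<forall>K :: nat \<Rightarrow> 'a set. (\<forall>n. ideal_in B (K n)) \<and> (\<forall>n. K n \<subseteq> K (Suc n)) \<longrightarrow>
        (\<exists>M. \<forall>n\<ge>M. K n = K M))"

lemma noetherianD:
  "noetherian B \<Longrightarrow> (\<And>n. ideal_in B (K n)) \<Longrightarrow> (\<And>n. K n \<subseteq> K (Suc n)) \<Longrightarrow>
     \<exists>M. \<forall>n\<ge>M. K n = K (M :: nat)"
  unfolding noetherian_def by blast

lemma subring_zero: "subring B \<Longrightarrow> 0 \<in> B"
  unfolding subring_def by (metis diff_self)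

lemma subring_uminus: "subring B \<Longrightarrow> a \<in> B \<Longrightarrow> - a \<in> B"
  using subring_zero[of B] unfolding subring_def by (metis diff_0)

lemma subring_add: "subring B \<Longrightarrow> a \<in> B \<Longrightarrow> b \<in> B \<Longrightarrow> a + b \<in> B"
  using subring_uminus[of B b] unfolding subring_def by (metis diff_minus_eq_add)

lemma subring_diff: "subring B \<Longrightarrow> a \<in> B \<Longrightarrow> b \<in> B \<Longrightarrow> a - b \<in> B"
  unfolding subring_def by blast

lemma subring_mult: "subring B \<Longrightarrow> a \<in> B \<Longrightarrow> b \<in> B \<Longrightarrow> a * b \<in> B"
  unfolding subring_def by blast

lemma ideal_in_zero: "ideal_in B I \<Longrightarrow> 0 \<in> I"
  and ideal_in_add: "ideal_in B I \<Longrightarrow> a \<in> I \<Longrightarrow> b \<in> I \<Longrightarrow> a + b \<in> I"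
  and ideal_in_mult: "ideal_in B I \<Longrightarrow> c \<in> B \<Longrightarrow> a \<in> I \<Longrightarrow> c * a \<in> I"
  and ideal_in_subset: "ideal_in B I \<Longrightarrow> I \<subseteq> B"
  unfolding ideal_in_def by blast+

lemma ideal_in_diff:
  assumes "subring B" "ideal_in B I" "a \<in> I" "b \<in> I"
  shows "a - b \<in> I"
proof -
  have "- 1 \<in> B"
    using assms(1) subring_uminus unfolding subring_def by blast
  from ideal_in_mult[OF assms(2) this assms(4)] have "- b \<in> I" by simp
  from ideal_in_add[OF assms(2,3) this] show ?thesis by simp
qed

lemma subring_UNIV: "subring UNIV"
  by (simp add: subring_def)

lemma ideal_mult_left: "ideal I \<Longrightarrow> a \<in> I \<Longrightarrow> c * a \<in> I"
  by (rule ideal_in_mult) auto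

lemma ideal_diff: "ideal I \<Longrightarrow> a \<in> I \<Longrightarrow> b \<in> I \<Longrightarrow> a - b \<in> I"
  by (rule ideal_in_diff[OF subring_UNIV])

lemma ideal_sum: "ideal I \<Longrightarrow> (\<And>a. a \<in> A \<Longrightarrow> f a \<in> I) \<Longrightarrow> sum f A \<in> I"
  by (induction A rule: infinite_finite_induct) (auto intro: ideal_in_zero ideal_in_add)

section \<open>Adjoining one element to a subring\<close>

primrec poly_upto :: "'a::comm_ring_1 set \<Rightarrow> 'a \<Rightarrow> nat \<Rightarrow> 'a set" where
  "poly_upto B x 0 = {0}"
| "poly_upto B x (Suc n) = {b * x ^ n + p | b p. b \<in> B \<and> p \<in> poly_upto B x n}"

text \<open>\<open>poly_upto B x n\<close> holds the values at \<open>x\<close> of polynomials over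
  \<open>B\<close> of degree below \<open>n\<close>. Since \<open>x\<close> may satisfy relations
  over \<open>B\<close>, coefficients are not determined by the value, and \<open>n\<close> is only
  a bound on a formal degree.\<close>

definition adjoin :: "'a::comm_ring_1 set \<Rightarrow> 'a \<Rightarrow> 'a set" where
  "adjoin B x = (\<Union>n. poly_upto B x n)"

lemma poly_upto_SucI: "b \<in> B \<Longrightarrow> p \<in> poly_upto B x n \<Longrightarrow> b * x ^ n + p \<in> poly_upto B x (Suc n)"
  by auto

context
  fixes B :: "'a::comm_ring_1 set" and x :: 'a
  assumes B: "subring B"
begin

lemma poly_upto_mono: "m \<le> n \<Longrightarrow> poly_upto B x m \<subseteq> poly_upto B x n"
proof (induction rule: dec_induct)
  case (step n)
  have "p \<in> poly_upto B x (Suc n)" if "p \<in> poly_upto B x n" for p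
    using poly_upto_SucI[OF subring_zero[OF B] that] by simp
  with step show ?case by blast
qed simp

lemma poly_upto_zero: "0 \<in> poly_upto B x n"
  using poly_upto_mono[of 0 n] by simp

lemma poly_upto_diff: "p \<in> poly_upto B x n \<Longrightarrow> q \<in> poly_upto B x n \<Longrightarrow> p - q \<in> poly_upto B x n"
proof (induction n arbitrary: p q)
  case (Suc n)
  then obtain b p' c q' where *: "b \<in> B" "c \<in> B" "p' \<in> poly_upto B x n" "q' \<in> poly_upto B x n"
    "p = b * x ^ n + p'" "q = c * x ^ n + q'"
    by auto
  have "p - q = (b - c) * x ^ n + (p' - q')"
    by (simp add: * algebra_simps)
  then show ?case
    using poly_upto_SucI[OF subring_diff[OF B *(1,2)] Suc.IH[OF *(3,4)]] by simp
qed simp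

lemma poly_upto_add: "p \<in> poly_upto B x n \<Longrightarrow> q \<in> poly_upto B x n \<Longrightarrow> p + q \<in> poly_upto B x n"
  using poly_upto_diff[of p n "0 - q"] poly_upto_diff[OF poly_upto_zero, of q n] by simp

lemma poly_upto_smult: "c \<in> B \<Longrightarrow> p \<in> poly_upto B x n \<Longrightarrow> c * p \<in> poly_upto B x n"
proof (induction n arbitrary: p)
  case (Suc n)
  then obtain b p' where *: "b \<in> B" "p' \<in> poly_upto B x n" "p = b * x ^ n + p'"
    by auto
  have "c * p = (c * b) * x ^ n + c * p'"
    by (simp add: * algebra_simps)
  then show ?case
    using poly_upto_SucI[OF subring_mult[OF B Suc.prems(1) *(1)] Suc.IH[OF Suc.prems(1) *(2)]]
    by simp
qed simp

lemma poly_upto_shift: "p \<in> poly_upto B x n \<Longrightarrow> x * p \<in> poly_upto B x (Suc n)"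
proof (induction n arbitrary: p)
  case 0
  then show ?case using poly_upto_zero[of "Suc 0"] by simp
next
  case (Suc n)
  then obtain b p' where *: "b \<in> B" "p' \<in> poly_upto B x n" "p = b * x ^ n + p'"
    by auto
  have "x * p = b * x ^ Suc n + x * p'"
    by (simp add: * algebra_simps)
  then show ?case
    using poly_upto_SucI[OF *(1) Suc.IH[OF *(2)]] by simp
qed

lemma poly_upto_shifts: "p \<in> poly_upto B x n \<Longrightarrow> x ^ m * p \<in> poly_upto B x (m + n)"
  by (induction m) (auto simp: mult.assoc simp del: poly_upto.simps dest: poly_upto_shift)

lemma poly_upto_mult:
  "p \<in> poly_upto B x m \<Longrightarrow> q \<in> poly_upto B x n \<Longrightarrow> p * q \<in> poly_upto B x (m + n)"
proof (induction m arbitrary: p)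
  case 0
  then show ?case using poly_upto_zero by simp
next
  case (Suc m)
  then obtain b p' where *: "b \<in> B" "p' \<in> poly_upto B x m" "p = b * x ^ m + p'"
    by auto
  have "p * q = b * (x ^ m * q) + p' * q"
    by (simp add: * algebra_simps)
  moreover have "\<dots> \<in> poly_upto B x (m + n)"
    using poly_upto_add poly_upto_smult[OF *(1) poly_upto_shifts[OF Suc.prems(2)]]
      Suc.IH[OF *(2) Suc.prems(2)] by blast
  ultimately show ?case
    using poly_upto_mono[of "m + n" "Suc m + n"] by auto
qed

lemma poly_upto_adjoin: "poly_upto B x n \<subseteq> adjoin B x"
  by (auto simp: adjoin_def)

lemma subset_adjoin: "B \<subseteq> adjoin B x"
proof
  fix b assume "b \<in> B"
  then have "b * x ^ 0 + 0 \<in> poly_upto B x (Suc 0)"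
    by (intro poly_upto_SucI) auto
  then show "b \<in> adjoin B x" using poly_upto_adjoin[of "Suc 0"] by auto
qed

lemma gen_in_adjoin: "x \<in> adjoin B x"
proof -
  have "1 * x ^ 1 + 0 \<in> poly_upto B x (Suc 1)"
    using B poly_upto_zero[of 1] by (intro poly_upto_SucI) (auto simp: subring_def)
  then show ?thesis using poly_upto_adjoin[of "Suc 1"] by auto
qed

lemma adjoin_common:
  assumes "p \<in> adjoin B x" "q \<in> adjoin B x"
  obtains n where "p \<in> poly_upto B x n" "q \<in> poly_upto B x n"
proof -
  obtain i j where "p \<in> poly_upto B x i" "q \<in> poly_upto B x j"
    using assms by (auto simp: adjoin_def)
  with poly_upto_mono[of i "max i j"] poly_upto_mono[of j "max i j"] show ?thesis
    using that[of "max i j"] by auto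
qed

lemma subring_adjoin: "subring (adjoin B x)"
  unfolding subring_def
proof (intro conjI ballI)
  show "1 \<in> adjoin B x" using subset_adjoin B by (auto simp: subring_def)
next
  fix p q assume "p \<in> adjoin B x" "q \<in> adjoin B x"
  then obtain n where "p \<in> poly_upto B x n" "q \<in> poly_upto B x n" by (rule adjoin_common)
  then show "p - q \<in> adjoin B x" "p * q \<in> adjoin B x"
    using poly_upto_diff poly_upto_mult poly_upto_adjoin by blast+
qed

text \<open>Formal leading coefficients: zero is allowed, and one element of \<open>K\<close> may
  contribute several coefficients through its different representations.\<close>

definition leading_coeffs :: "'a set \<Rightarrow> nat \<Rightarrow> 'a set" where
  "leading_coeffs K n = {b \<in> B. \<exists>p\<in>poly_upto B x n. b * x ^ n + p \<in> K}"

lemma ideal_in_leading_coeffs: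
  assumes K: "ideal_in (adjoin B x) K"
  shows "ideal_in B (leading_coeffs K n)"
  unfolding ideal_in_def
proof (intro conjI ballI)
  show "leading_coeffs K n \<subseteq> B" by (auto simp: leading_coeffs_def)
  show "0 \<in> leading_coeffs K n"
    unfolding leading_coeffs_def
    using subring_zero[OF B] poly_upto_zero[of n] ideal_in_zero[OF K] by force
next
  fix a b assume "a \<in> leading_coeffs K n" "b \<in> leading_coeffs K n"
  then obtain p q where *: "a \<in> B" "b \<in> B" "p \<in> poly_upto B x n" "q \<in> poly_upto B x n"
    "a * x ^ n + p \<in> K" "b * x ^ n + q \<in> K"
    by (auto simp: leading_coeffs_def)
  have "(a + b) * x ^ n + (p + q) = (a * x ^ n + p) + (b * x ^ n + q)"
    by (simp add: algebra_simps)
  then have "(a + b) * x ^ n + (p + q) \<in> K"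
    using ideal_in_add[OF K *(5,6)] by (simp only:)
  then show "a + b \<in> leading_coeffs K n"
    unfolding leading_coeffs_def
    using subring_add[OF B *(1,2)] poly_upto_add[OF *(3,4)] by blast
next
  fix c a assume c: "c \<in> B" and "a \<in> leading_coeffs K n"
  then obtain p where *: "a \<in> B" "p \<in> poly_upto B x n" "a * x ^ n + p \<in> K"
    by (auto simp: leading_coeffs_def)
  have "(c * a) * x ^ n + c * p = c * (a * x ^ n + p)"
    by (simp add: algebra_simps)
  then have "(c * a) * x ^ n + c * p \<in> K"
    using ideal_in_mult[OF K _ *(3), of c] subset_adjoin c by auto
  then show "c * a \<in> leading_coeffs K n"
    unfolding leading_coeffs_def
    using subring_mult[OF B c *(1)] poly_upto_smult[OF c *(2)] by blast
qed

lemma leading_coeffs_Suc: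
  assumes K: "ideal_in (adjoin B x) K"
  shows "leading_coeffs K n \<subseteq> leading_coeffs K (Suc n)"
proof
  fix b assume "b \<in> leading_coeffs K n"
  then obtain p where *: "b \<in> B" "p \<in> poly_upto B x n" "b * x ^ n + p \<in> K"
    by (auto simp: leading_coeffs_def)
  have "b * x ^ Suc n + x * p = x * (b * x ^ n + p)"
    by (simp add: algebra_simps)
  then have "b * x ^ Suc n + x * p \<in> K"
    using ideal_in_mult[OF K gen_in_adjoin *(3)] by simp
  then show "b \<in> leading_coeffs K (Suc n)"
    unfolding leading_coeffs_def using *(1) poly_upto_shift[OF *(2)] by blast
qed

lemma leading_coeffs_mono_degree:
  assumes "ideal_in (adjoin B x) K" "m \<le> n"
  shows "leading_coeffs K m \<subseteq> leading_coeffs K n"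
  using leading_coeffs_Suc[OF assms(1)] assms(2) by (rule lift_Suc_mono_le)

lemma leading_coeffs_mono: "K \<subseteq> K' \<Longrightarrow> leading_coeffs K n \<subseteq> leading_coeffs K' n"
  unfolding leading_coeffs_def by blast

text \<open>Induction on the degree bound: subtracting an element of \<open>K\<close> with the same
  top coefficient leaves an element of \<open>K'\<close> with a smaller bound. Ambiguous
  representations do no harm, as one suitable representation suffices.\<close>

lemma ideal_eq_of_leading_coeffs:
  assumes K: "ideal_in (adjoin B x) K" and K': "ideal_in (adjoin B x) K'" and sub: "K \<subseteq> K'"
    and lead: "\<And>d. leading_coeffs K' d \<subseteq> leading_coeffs K d"
  shows "K = K'"
proof -
  have "f \<in> K" if "f \<in> poly_upto B x n" "f \<in> K'" for f n
    using that
  proof (induction n arbitrary: f)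
    case 0
    then show ?case using ideal_in_zero[OF K] by simp
  next
    case (Suc n)
    then obtain b p where *: "b \<in> B" "p \<in> poly_upto B x n" "f = b * x ^ n + p" by auto
    then have "b \<in> leading_coeffs K' n" using Suc.prems by (auto simp: leading_coeffs_def)
    then obtain q where q: "q \<in> poly_upto B x n" "b * x ^ n + q \<in> K"
      using lead[of n] by (auto simp: leading_coeffs_def)
    have "f - (b * x ^ n + q) \<in> K'"
      using ideal_in_diff[OF subring_adjoin K' Suc.prems(2)] q(2) sub by blast
    then have "p - q \<in> K'" by (simp add: *)
    then have "p - q \<in> K"
      using Suc.IH[OF poly_upto_diff[OF *(2) q(1)]] by blast
    from ideal_in_add[OF K q(2) this] show ?case by (simp add: *)
  qed
  then show ?thesis
    using sub ideal_in_subset[OF K'] by (fastforce simp: adjoin_def)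
qed

text \<open>Hilbert's basis theorem: for an ascending chain of ideals the ideals of leading coefficients
  stabilize along the diagonal of chain index and degree, at \<open>N\<close> say, and separately in each of the
  finitely many degrees below \<open>N\<close>.\<close>

lemma noetherian_adjoin:
  assumes noeth: "noetherian B"
  shows "noetherian (adjoin B x)"
  unfolding noetherian_def
proof (intro allI impI)
  fix K :: "nat \<Rightarrow> 'a set"
  assume "(\<forall>n. ideal_in (adjoin B x) (K n)) \<and> (\<forall>n. K n \<subseteq> K (Suc n))"
  then have K: "\<And>n. ideal_in (adjoin B x) (K n)" and step: "\<And>n. K n \<subseteq> K (Suc n)" by auto
  have mono: "m \<le> n \<Longrightarrow> K m \<subseteq> K n" for m n
    using step by (rule lift_Suc_mono_le)
  \<comment> \<open>One statement about pairs of monotone indices covers both uses: the diagonal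
    \<open>(n, n)\<close> and a fixed degree \<open>(n, d)\<close>.\<close>
  have stat: "\<exists>M. \<forall>n\<ge>M. leading_coeffs (K (u n)) (v n) = leading_coeffs (K (u M)) (v M)"
    if "\<And>n. u n \<le> u (Suc n)" "\<And>n. v n \<le> v (Suc n)" for u v :: "nat \<Rightarrow> nat"
  proof -
    have "leading_coeffs (K (u n)) (v n) \<subseteq> leading_coeffs (K (u (Suc n))) (v (Suc n))" for n
      using leading_coeffs_mono_degree[OF K that(2)] leading_coeffs_mono[OF mono[OF that(1)]]
      by blast
    then show ?thesis
      using ideal_in_leading_coeffs[OF K]
      by (intro noetherianD[OF noeth, of "\<lambda>n. leading_coeffs (K (u n)) (v n)"]) simp_all
  qed
  obtain N where N: "\<And>n. n \<ge> N \<Longrightarrow> leading_coeffs (K n) n = leading_coeffs (K N) N"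
    using stat[of "\<lambda>n. n" "\<lambda>n. n"] by auto
  have "\<forall>d. \<exists>M. \<forall>n\<ge>M. leading_coeffs (K n) d = leading_coeffs (K M) d"
    using stat[of "\<lambda>n. n" "\<lambda>n. _"] by auto
  then obtain S where S: "\<And>d n. n \<ge> S d \<Longrightarrow> leading_coeffs (K n) d = leading_coeffs (K (S d)) d"
    by metis
  define M where "M = Max (insert N (S ` {..<N}))"
  have MN: "N \<le> M" and MS: "d < N \<Longrightarrow> S d \<le> M" for d
    by (auto simp: M_def intro!: Max_ge)
  have "K n = K M" if "n \<ge> M" for n
  proof (rule sym, rule ideal_eq_of_leading_coeffs[OF K K mono[OF that]])
    fix d
    show "leading_coeffs (K n) d \<subseteq> leading_coeffs (K M) d"
    proof (cases "d < N")
      case True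
      then show ?thesis using S[of d n] S[of d M] MS[of d] that by auto
    next
      \<comment> \<open>In a degree \<open>d\<close> of at least \<open>N\<close>, everything is
        squeezed between the value at \<open>(N, N)\<close> and the diagonal entry at
        \<open>max n d\<close>, which equals it.\<close>
      case False
      have "leading_coeffs (K n) d \<subseteq> leading_coeffs (K (max n d)) (max n d)"
        using leading_coeffs_mono_degree[OF K, of d "max n d"] leading_coeffs_mono[OF mono, of n "max n d"]
        by fastforce
      also have "\<dots> = leading_coeffs (K N) N"
        using N[of "max n d"] False by auto
      also have "\<dots> \<subseteq> leading_coeffs (K M) d"
        using leading_coeffs_mono_degree[OF K, of N d] leading_coeffs_mono[OF mono[OF MN]] False
        by fastforce
      finally show ?thesis .
    qed
  qed
  then show "\<exists>M. \<forall>n\<ge>M. K n = K M" by blast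
qed

end

section \<open>Zero divisors modulo an ideal of a Noetherian ring\<close>

text \<open>The colon ideal \<open>(N : y)\<close>, that is, the annihilator of the class of
  \<open>y\<close> modulo \<open>N\<close>.\<close>

definition annihilator_mod :: "'a::comm_ring_1 set \<Rightarrow> 'a \<Rightarrow> 'a set" where
  "annihilator_mod N y = {a. a * y \<in> N}"

text \<open>Those associated primes of the quotient by \<open>N\<close> that are maximal among
  annihilators of nonzero classes; in the Noetherian case their union is the set of zero divisors
  modulo \<open>N\<close>.\<close>

definition maximal_annihilators :: "'a::comm_ring_1 set \<Rightarrow> 'a set set" where
  "maximal_annihilators N = {P. (\<exists>y. y \<notin> N \<and> P = annihilator_mod N y) \<and>
     (\<forall>y. y \<notin> N \<longrightarrow> P \<subseteq> annihilator_mod N y \<longrightarrow> annihilator_mod N y = P)}"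

definition prime_ideal :: "'a::comm_ring_1 set \<Rightarrow> bool" where
  "prime_ideal P \<longleftrightarrow> ideal P \<and> 1 \<notin> P \<and> (\<forall>a b. a * b \<in> P \<longrightarrow> a \<in> P \<or> b \<in> P)"

lemma ideal_annihilator_mod: "ideal N \<Longrightarrow> ideal (annihilator_mod N y)"
  unfolding ideal_in_def annihilator_mod_def by (auto simp: distrib_right mult.assoc)

text \<open>Otherwise choice gives a strictly larger member above each member containing
  \<open>K0\<close>, and iterating from \<open>K0\<close> violates the chain condition.\<close>

lemma noetherian_maximal:
  assumes "noetherian B" "\<And>K. K \<in> F \<Longrightarrow> ideal_in B K" "K0 \<in> F"
  shows "\<exists>K\<in>F. K0 \<subseteq> K \<and> (\<forall>K'\<in>F. K \<subseteq> K' \<longrightarrow> K' = K)"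
proof (rule ccontr)
  assume "\<not> ?thesis"
  then have "\<forall>K. \<exists>K'. K \<in> F \<and> K0 \<subseteq> K \<longrightarrow> K' \<in> F \<and> K \<subseteq> K' \<and> K' \<noteq> K"
    by (simp only: bex_simps ball_simps de_Morgan_conj Bex_def Ball_def not_ex not_all) blast
  then obtain g where
    g: "\<And>K. K \<in> F \<and> K0 \<subseteq> K \<Longrightarrow> g K \<in> F \<and> K \<subseteq> g K \<and> g K \<noteq> K"
    using choice[of "\<lambda>K K'. K \<in> F \<and> K0 \<subseteq> K \<longrightarrow> K' \<in> F \<and> K \<subseteq> K' \<and> K' \<noteq> K"] by blast
  define c where "c n = (g ^^ n) K0" for n
  have c: "c n \<in> F \<and> K0 \<subseteq> c n" for n
  proof (induction n)
    case (Suc n)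
    then show ?case using g[OF Suc] by (auto simp: c_def)
  qed (use assms(3) in \<open>auto simp: c_def\<close>)
  have less: "c n \<subseteq> c (Suc n) \<and> c (Suc n) \<noteq> c n" for n
    using g[OF c[of n]] by (simp add: c_def)
  have "\<exists>M. \<forall>n\<ge>M. c n = c M"
    using assms(2) c less by (intro noetherianD[OF assms(1)]) auto
  then obtain M where "\<forall>n\<ge>M. c n = c M" by blast
  then have "c (Suc M) = c M" by (meson le_SucI order_refl)
  with less show False by blast
qed

lemma maximal_annihilator_above:
  fixes N :: "'a::comm_ring_1 set"
  assumes "noetherian (UNIV :: 'a set)" "ideal N" "y \<notin> N"
  shows "\<exists>P\<in>maximal_annihilators N. annihilator_mod N y \<subseteq> P"
proof -
  have "\<exists>K\<in>annihilator_mod N ` (- N). annihilator_mod N y \<subseteq> K \<and>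
      (\<forall>K'\<in>annihilator_mod N ` (- N). K \<subseteq> K' \<longrightarrow> K' = K)"
    using ideal_annihilator_mod[OF assms(2)] assms(3)
    by (intro noetherian_maximal[OF assms(1)]) auto
  then obtain z where "z \<notin> N" "annihilator_mod N y \<subseteq> annihilator_mod N z"
    "\<forall>K'\<in>annihilator_mod N ` (- N). annihilator_mod N z \<subseteq> K' \<longrightarrow> K' = annihilator_mod N z"
    by auto
  moreover from this(1,3) have "annihilator_mod N z \<in> maximal_annihilators N"
    unfolding maximal_annihilators_def by auto
  ultimately show ?thesis by blast
qed

text \<open>If \<open>a\<close> is outside \<open>P = (N : y)\<close>, then \<open>a * y\<close> is
  not in \<open>N\<close> and \<open>(N : a * y)\<close> contains \<open>P\<close>, hence equals it
  by maximality. From \<open>a * b \<in> P\<close> it follows that \<open>b\<close> annihilates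
  \<open>a * y\<close>.\<close>

lemma prime_maximal_annihilator:
  assumes N: "ideal N" and P: "P \<in> maximal_annihilators N"
  shows "prime_ideal P"
proof -
  obtain y where y: "y \<notin> N" "P = annihilator_mod N y"
    using P by (auto simp: maximal_annihilators_def)
  have "b \<in> P" if "a * b \<in> P" "a \<notin> P" for a b
  proof -
    have "a * y \<notin> N" using that(2) y(2) by (auto simp: annihilator_mod_def)
    moreover have "P \<subseteq> annihilator_mod N (a * y)"
      using ideal_mult_left[OF N] by (auto simp: y(2) annihilator_mod_def mult.left_commute[of _ a])
    ultimately have "annihilator_mod N (a * y) = P"
      using P by (auto simp: maximal_annihilators_def)
    moreover have "b \<in> annihilator_mod N (a * y)"
      using that(1) by (simp add: y(2) annihilator_mod_def ac_simps)
    ultimately show ?thesis by blast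
  qed
  then show ?thesis
    using ideal_annihilator_mod[OF N] y unfolding prime_ideal_def
    by (auto simp: annihilator_mod_def)
qed

lemma prime_ideal_prod:
  "finite A \<Longrightarrow> prime_ideal P \<Longrightarrow> (\<And>a. a \<in> A \<Longrightarrow> f a \<notin> P) \<Longrightarrow> prod f A \<notin> P"
  by (induction A rule: finite_induct) (auto simp: prime_ideal_def)

lemma ideal_prod: "ideal I \<Longrightarrow> finite A \<Longrightarrow> a \<in> A \<Longrightarrow> f a \<in> I \<Longrightarrow> prod f A \<in> I"
  using ideal_mult_left[of I "f a" "prod f (A - {a})"]
  by (simp add: prod.remove[of A a f] mult.commute)

lemma prime_ideal_Inter:
  assumes P: "prime_ideal P" and "finite M" "\<And>Q. Q \<in> M \<Longrightarrow> ideal Q" "\<Inter>M \<subseteq> P"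
  shows "\<exists>Q\<in>M. Q \<subseteq> P"
proof (rule ccontr)
  assume "\<not> ?thesis"
  then have "\<forall>Q\<in>M. \<exists>c. c \<in> Q \<and> c \<notin> P" by blast
  then obtain c where c: "\<And>Q. Q \<in> M \<Longrightarrow> c Q \<in> Q \<and> c Q \<notin> P" by metis
  then have "prod c M \<notin> P"
    using prime_ideal_prod[OF assms(2) P] by blast
  moreover have "prod c M \<in> \<Inter>M"
    using ideal_prod[OF assms(3) assms(2)] c by blast
  ultimately show False using assms(4) by blast
qed

lemma ideal_hull: "ideal (ideal hull X)"
  by (rule hull_in) (auto simp: ideal_in_def)

text \<open>For witnesses \<open>y i\<close> of distinct maximal annihilators \<open>P i\<close>,
  the ideals generated by \<open>N\<close> and the first \<open>n\<close> witnesses stabilize, so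
  some \<open>y M\<close> lies in the ideal of the earlier ones. Whatever kills those modulo
  \<open>N\<close> kills \<open>y M\<close>: the intersection of the earlier \<open>P j\<close> lies
  in \<open>P M\<close>. By primality one \<open>P j\<close> lies in \<open>P M\<close>, and
  maximality makes them equal.\<close>

lemma finite_maximal_annihilators:
  fixes N :: "'a::comm_ring_1 set"
  assumes noeth: "noetherian (UNIV :: 'a set)" and N: "ideal N"
  shows "finite (maximal_annihilators N)"
proof (rule ccontr)
  assume "infinite (maximal_annihilators N)"
  from infinite_countable_subset[OF this] obtain P :: "nat \<Rightarrow> 'a set"
    where inj: "inj P" and "range P \<subseteq> maximal_annihilators N"
    by (elim exE conjE)
  then have P: "P i \<in> maximal_annihilators N" for i by auto
  have "\<forall>i. \<exists>y. y \<notin> N \<and> P i = annihilator_mod N y"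
    using P unfolding maximal_annihilators_def by blast
  then obtain y where y: "\<And>i. y i \<notin> N \<and> P i = annihilator_mod N (y i)" by metis
  define K where "K n = ideal hull (N \<union> y ` {..<n})" for n
  have "K n \<subseteq> K (Suc n)" for n
    unfolding K_def by (rule hull_mono) auto
  then have "\<exists>M. \<forall>n\<ge>M. K n = K M"
    by (intro noetherianD[OF noeth]) (simp_all add: K_def ideal_hull)
  then obtain M where "\<forall>n\<ge>M. K n = K M" by blast
  then have "K (Suc M) = K M" by (meson le_SucI order_refl)
  moreover have "y M \<in> K (Suc M)"
    unfolding K_def by (rule hull_inc) auto
  ultimately have yM: "y M \<in> K M" by simp
  have "c \<in> P M" if c: "c \<in> \<Inter>(P ` {..<M})" for c
  proof -
    have "ideal {a. c * a \<in> N}"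
      using N by (auto simp: ideal_in_def distrib_left mult.left_commute)
    moreover have "N \<union> y ` {..<M} \<subseteq> {a. c * a \<in> N}"
      using c y ideal_mult_left[OF N] by (auto simp: annihilator_mod_def)
    ultimately have "K M \<subseteq> {a. c * a \<in> N}"
      unfolding K_def by (intro hull_minimal)
    then show ?thesis using yM y by (auto simp: annihilator_mod_def)
  qed
  then have "\<Inter>(P ` {..<M}) \<subseteq> P M" by (rule subsetI)
  moreover have "ideal Q" if "Q \<in> P ` {..<M}" for Q
    using that y ideal_annihilator_mod[OF N] by auto
  ultimately have "\<exists>Q\<in>P ` {..<M}. Q \<subseteq> P M"
    by (intro prime_ideal_Inter prime_maximal_annihilator[OF N P]) auto
  then obtain j where "j < M" and sub: "P j \<subseteq> P M" by blast
  have "y M \<notin> N" "P M = annihilator_mod N (y M)" using y[of M] by blast+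
  then have "P M = P j"
    using P[of j] sub unfolding maximal_annihilators_def by blast
  then show False using inj \<open>j < M\<close> by (auto simp: inj_def)
qed

text \<open>\<open>F\<close> is only an ideal of a subring, so the usual reduction to incomparable primes is
  replaced by one to primes with incomparable traces on \<open>F\<close>.\<close>

lemma prime_avoidance:
  assumes add: "\<And>a b. a \<in> F \<Longrightarrow> b \<in> F \<Longrightarrow> a + b \<in> F"
    and mult: "\<And>a b. a \<in> F \<Longrightarrow> b \<in> F \<Longrightarrow> a * b \<in> F"
    and "F \<noteq> {}"
    and "finite M" and "\<And>P. P \<in> M \<Longrightarrow> prime_ideal P \<and> \<not> F \<subseteq> P"
  shows "\<exists>a\<in>F. a \<notin> \<Union>M"
  using assms(4,5)
proof (induction "card M" arbitrary: M rule: less_induct)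
  case less
  show ?case
  proof (cases "\<exists>Q\<in>M. \<exists>P\<in>M. Q \<noteq> P \<and> F \<inter> Q \<subseteq> P")
    case True
    then obtain P Q where PQ: "P \<in> M" "Q \<in> M" "P \<noteq> Q" "F \<inter> Q \<subseteq> P" by blast
    have "\<exists>a\<in>F. a \<notin> \<Union>(M - {Q})"
      using less.prems PQ(2) by (intro less.hyps card_Diff1_less) auto
    then show ?thesis using PQ by blast
  next
    case False
    show ?thesis
    proof (cases "M = {}")
      case True
      then show ?thesis using \<open>F \<noteq> {}\<close> by auto
    next
      case False
      then obtain P where P: "P \<in> M" by blast
      define M' where "M' = M - {P}"
      have fin: "finite M'" using less.prems by (simp add: M'_def)
      have "\<exists>a\<in>F. a \<notin> \<Union>M'"
        using less.prems P unfolding M'_def by (intro less.hyps card_Diff1_less) auto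
      then obtain a where a: "a \<in> F" "a \<notin> \<Union>M'" by blast
      obtain b where b: "b \<in> F" "b \<notin> P" using less.prems(2)[OF P] by blast
      have "\<forall>Q\<in>M'. \<exists>c. c \<in> F \<and> c \<in> Q \<and> c \<notin> P"
        using \<open>\<not> (\<exists>Q\<in>M. \<exists>P\<in>M. Q \<noteq> P \<and> F \<inter> Q \<subseteq> P)\<close> P unfolding M'_def by blast
      then obtain c where c: "\<And>Q. Q \<in> M' \<Longrightarrow> c Q \<in> F \<and> c Q \<in> Q \<and> c Q \<notin> P" by metis
      \<comment> \<open>\<open>u\<close> lies in every prime except \<open>P\<close>, so it can be
        added to \<open>a\<close> if \<open>a\<close> lies in \<open>P\<close>. The factor
        \<open>b\<close> keeps \<open>u\<close> in \<open>F\<close> even when \<open>M'\<close> is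
        empty, as \<open>F\<close> need not contain 1.\<close>
      define u where "u = b * prod c M'"
      have "b * prod c A \<in> F" if "finite A" "A \<subseteq> M'" for A
        using that
      proof (induction A rule: finite_induct)
        case (insert Q A)
        then have "c Q * (b * prod c A) \<in> F" using mult c by simp
        then show ?case using insert by (simp add: mult.left_commute)
      qed (use b in simp)
      then have u: "u \<in> F" using fin by (simp add: u_def)
      have uP: "u \<notin> P"
        using less.prems(2)[OF P] prime_ideal_prod[of M' P c] fin b c
        unfolding u_def prime_ideal_def by blast
      have uQ: "u \<in> Q" if "Q \<in> M'" for Q
        using less.prems(2)[of Q] that c[OF that] fin ideal_mult_left[OF _ ideal_prod[of Q M' Q c]]
        unfolding u_def prime_ideal_def M'_def by blast
      show ?thesis
      proof (cases "a \<in> P")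
        case False
        then show ?thesis using a by (auto simp: M'_def)
      next
        case True
        have idP: "ideal P" using less.prems(2)[OF P] by (simp add: prime_ideal_def)
        have "a + u \<notin> P"
          using ideal_diff[OF idP, of "a + u" a] True uP by auto
        moreover have "a + u \<notin> Q" if "Q \<in> M'" for Q
        proof -
          have "ideal Q" using less.prems(2)[of Q] that by (simp add: prime_ideal_def M'_def)
          then show ?thesis using ideal_diff[of Q "a + u" u] uQ[OF that] a(2) that by auto
        qed
        ultimately show ?thesis using add[OF a(1) u] by (auto simp: M'_def)
      qed
    qed
  qed
qed

text \<open>A maximal annihilator containing \<open>F\<close> would give some \<open>y\<close>
  outside \<open>N\<close> with \<open>F * y\<close> inside \<open>N\<close>, against the last
  assumption. So \<open>F\<close> lies in none of these finitely many primes, and an element of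
  \<open>F\<close> avoiding them all is no zero divisor modulo \<open>N\<close>.\<close>

lemma exists_regular_element:
  fixes N :: "'a::comm_ring_1 set"
  assumes noeth: "noetherian (UNIV :: 'a set)" and N: "ideal N"
    and add: "\<And>a b. a \<in> F \<Longrightarrow> b \<in> F \<Longrightarrow> a + b \<in> F"
    and mult: "\<And>a b. a \<in> F \<Longrightarrow> b \<in> F \<Longrightarrow> a * b \<in> F"
    and "F \<noteq> {}"
    and socle: "\<And>y. (\<And>a. a \<in> F \<Longrightarrow> a * y \<in> N) \<Longrightarrow> y \<in> N"
  shows "\<exists>f\<in>F. \<forall>y. f * y \<in> N \<longrightarrow> y \<in> N"
proof -
  have "prime_ideal P \<and> \<not> F \<subseteq> P" if P: "P \<in> maximal_annihilators N" for P
    using prime_maximal_annihilator[OF N P] P socle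
    by (auto simp: maximal_annihilators_def annihilator_mod_def)
  then obtain f where "f \<in> F" "f \<notin> \<Union>(maximal_annihilators N)"
    using prime_avoidance[OF add mult \<open>F \<noteq> {}\<close> finite_maximal_annihilators[OF noeth N]] by blast
  moreover from this(2) have "y \<in> N" if "f * y \<in> N" for y
    using maximal_annihilator_above[OF noeth N, of y] that by (auto simp: annihilator_mod_def)
  ultimately show ?thesis by blast
qed

section \<open>Koszul complexes\<close>

text \<open>The numbering \<open>idx\<close> stands in for a linear order on the vertices, which
  their type does not carry.\<close>

definition koszul_sign :: "('e \<Rightarrow> nat) \<Rightarrow> 'e \<Rightarrow> 'e set \<Rightarrow> 'a::comm_ring_1" where
  "koszul_sign idx e J = (- 1) ^ card {a \<in> J. idx a < idx e}"

lemma koszul_sign_square: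
  "koszul_sign idx e J * koszul_sign idx e J = (1 :: 'a::comm_ring_1)"
  by (simp add: koszul_sign_def flip: power_mult_distrib)

lemma koszul_sign_insert:
  assumes "finite J" "a \<notin> J"
  shows "koszul_sign idx b (insert a J) = (if idx a < idx b then - 1 else 1) * koszul_sign idx b J"
proof -
  have "{c \<in> insert a J. idx c < idx b} =
      (if idx a < idx b then insert a {c \<in> J. idx c < idx b} else {c \<in> J. idx c < idx b})"
    by auto
  then show ?thesis using assms by (simp add: koszul_sign_def)
qed

text \<open>Inserting the other vertex flips exactly one of the two signs, that of the vertex with
  the larger index.\<close>

lemma koszul_sign_swap:
  assumes "finite J" "a \<notin> J" "b \<notin> J" "idx a \<noteq> idx b"
  shows "koszul_sign idx a J * koszul_sign idx b (insert a J) =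
    (- 1 :: 'a::comm_ring_1) * (koszul_sign idx b J * koszul_sign idx a (insert b J))"
  using assms(4) by (cases "idx a < idx b") (simp_all add: koszul_sign_insert assms(1-3))

text \<open>The pairs are split by the order of their indices and matched by swapping. Deducing that
  twice the sum vanishes would not be enough in characteristic 2.\<close>

lemma sum_antisymmetric:
  fixes g :: "'e \<Rightarrow> 'e \<Rightarrow> 'a::ab_group_add" and idx :: "'e \<Rightarrow> nat"
  assumes "finite A" "inj_on idx A"
    and anti: "\<And>a b. a \<in> A \<Longrightarrow> b \<in> A \<Longrightarrow> a \<noteq> b \<Longrightarrow> g a b = - g b a"
  shows "(\<Sum>a\<in>A. \<Sum>b\<in>A - {a}. g a b) = 0"
proof -
  define L where "L = {(a, b). a \<in> A \<and> b \<in> A \<and> idx a < idx b}"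
  define R where "R = {(a, b). a \<in> A \<and> b \<in> A \<and> idx b < idx a}"
  have fin: "finite L" "finite R"
    by (rule finite_subset[of _ "A \<times> A"]; use assms(1) in \<open>auto simp: L_def R_def\<close>)+
  have "(\<Sum>a\<in>A. \<Sum>b\<in>A - {a}. g a b) = sum (case_prod g) (Sigma A (\<lambda>a. A - {a}))"
    using assms(1) by (intro sum.Sigma) auto
  also have "Sigma A (\<lambda>a. A - {a}) = L \<union> R"
    using assms(2) by (auto simp: L_def R_def inj_on_def) (metis nat_neq_iff)
  also have "sum (case_prod g) (L \<union> R) = sum (case_prod g) L + sum (case_prod g) R"
    by (rule sum.union_disjoint) (use fin in \<open>auto simp: L_def R_def\<close>)
  also have "sum (case_prod g) R = sum (\<lambda>(a, b). g b a) L"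
    by (rule sum.reindex_bij_witness[of _ prod.swap prod.swap]) (auto simp: L_def R_def)
  also have "\<dots> = sum (\<lambda>p. - case_prod g p) L"
    by (rule sum.cong) (auto simp: L_def intro: anti)
  finally show ?thesis by (simp add: sum_negf)
qed

definition extend_ideal :: "'a::comm_ring_1 set \<Rightarrow> 'a \<Rightarrow> 'a set" where
  "extend_ideal N f = {n + f * a | n a. n \<in> N}"

lemma extend_ideal_iff: "y \<in> extend_ideal N f \<longleftrightarrow> (\<exists>a. y - f * a \<in> N)"
proof
  assume "\<exists>a. y - f * a \<in> N"
  then obtain a where "y - f * a \<in> N" by blast
  then have "(y - f * a) + f * a \<in> extend_ideal N f" unfolding extend_ideal_def by blast
  then show "y \<in> extend_ideal N f" by simp
next
  assume "y \<in> extend_ideal N f"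
  then obtain n a where "n \<in> N" "y = n + f * a" unfolding extend_ideal_def by blast
  then have "y - f * a \<in> N" by simp
  then show "\<exists>a. y - f * a \<in> N" by blast
qed

lemma ideal_extend:
  assumes N: "ideal N"
  shows "ideal (extend_ideal N f)"
  unfolding ideal_in_def
proof (intro conjI ballI)
  have "0 - f * 0 \<in> N" using ideal_in_zero[OF N] by simp
  then show "0 \<in> extend_ideal N f" unfolding extend_ideal_iff by blast
  fix a b c assume "a \<in> extend_ideal N f"
  then obtain u where u: "a - f * u \<in> N" unfolding extend_ideal_iff by blast
  have "c * (a - f * u) = c * a - f * (c * u)" by (simp add: algebra_simps)
  with ideal_mult_left[OF N u, of c] have "c * a - f * (c * u) \<in> N" by simp
  then show "c * a \<in> extend_ideal N f" unfolding extend_ideal_iff by blast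
  assume "b \<in> extend_ideal N f"
  then obtain v where v: "b - f * v \<in> N" unfolding extend_ideal_iff by blast
  have "(a - f * u) + (b - f * v) = (a + b) - f * (u + v)" by (simp add: algebra_simps)
  with ideal_in_add[OF N u v] have "(a + b) - f * (u + v) \<in> N" by simp
  then show "a + b \<in> extend_ideal N f" unfolding extend_ideal_iff by blast
qed auto

text \<open>The coefficients \<open>x\<close> stay open because the complex is used twice: with
  \<open>x e = monom e\<close> over the semigroup algebra, and with \<open>x e = 1\<close> over the
  field, where it is the augmented chain complex of the full simplex on \<open>E\<close>.\<close>

locale koszul =
  fixes E :: "'e set" and idx :: "'e \<Rightarrow> nat" and x :: "'e \<Rightarrow> 'a::comm_ring_1"
  assumes finite_E: "finite E" and inj_idx: "inj_on idx E"
begin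

text \<open>One function \<open>z\<close> carries coefficients for sets of all sizes. The
  differential is written by cofaces: the coefficient at \<open>J\<close> collects what the sets
  \<open>insert e J\<close> send there.\<close>

definition boundary :: "('e set \<Rightarrow> 'a) \<Rightarrow> 'e set \<Rightarrow> 'a" where
  "boundary z J = (\<Sum>e\<in>E - J. koszul_sign idx e J * x e * z (insert e J))"

text \<open>Exterior multiplication by the basis vector of \<open>e\<close>; in simplicial terms,
  the join with the vertex \<open>e\<close>.\<close>

definition cone :: "'e \<Rightarrow> ('e set \<Rightarrow> 'a) \<Rightarrow> 'e set \<Rightarrow> 'a" where
  "cone e z J = (if e \<in> J then koszul_sign idx e (J - {e}) * z (J - {e}) else 0)"

lemma boundary_diff: "boundary (\<lambda>J. y J - z J) J = boundary y J - boundary z J"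
  by (simp add: boundary_def right_diff_distrib sum_subtractf)

lemma boundary_mult: "boundary (\<lambda>J. c * z J) J = c * boundary z J"
  by (simp add: boundary_def sum_distrib_left ac_simps)

lemma boundary_sum: "boundary (\<lambda>J. \<Sum>i\<in>I. z i J) J = (\<Sum>i\<in>I. boundary (z i) J)"
  unfolding boundary_def by (subst sum.swap) (simp add: sum_distrib_left)

lemma boundary_cong:
  assumes "J \<subseteq> E" "\<And>J'. J' \<subseteq> E \<Longrightarrow> card J' = Suc (card J) \<Longrightarrow> y J' = z J'"
  shows "boundary y J = boundary z J"
  unfolding boundary_def
proof (rule sum.cong)
  fix e assume "e \<in> E - J"
  then have "y (insert e J) = z (insert e J)"
    using assms(1) finite_subset[OF assms(1) finite_E] by (intro assms(2)) auto
  then show "koszul_sign idx e J * x e * y (insert e J) = koszul_sign idx e J * x e * z (insert e J)"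
    by simp
qed simp

lemma boundary_in_ideal:
  assumes "ideal N" "J \<subseteq> E" "\<And>J'. J' \<subseteq> E \<Longrightarrow> card J' = Suc (card J) \<Longrightarrow> z J' \<in> N"
  shows "boundary z J \<in> N"
  unfolding boundary_def
proof (intro ideal_sum ideal_mult_left assms(1))
  fix e assume "e \<in> E - J"
  then show "z (insert e J) \<in> N"
    using assms(2) finite_subset[OF assms(2) finite_E] by (intro assms(3)) auto
qed

lemma boundary_boundary:
  assumes "J \<subseteq> E"
  shows "boundary (boundary z) J = 0"
proof -
  have fin: "finite J" using assms finite_E finite_subset by blast
  let ?g = "\<lambda>a b. koszul_sign idx a J * x a *
    (koszul_sign idx b (insert a J) * x b * z (insert b (insert a J)))"
  have "boundary (boundary z) J = (\<Sum>a\<in>E - J. \<Sum>b\<in>(E - J) - {a}. ?g a b)"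
    unfolding boundary_def sum_distrib_left by (intro sum.cong) auto
  also have "\<dots> = 0"
  proof (rule sum_antisymmetric)
    fix a b assume ab: "a \<in> E - J" "b \<in> E - J" "a \<noteq> b"
    have "?g a b = (koszul_sign idx a J * koszul_sign idx b (insert a J)) *
        (x a * x b * z (insert a (insert b J)))"
      by (simp add: insert_commute ac_simps)
    also have "\<dots> = - ((koszul_sign idx b J * koszul_sign idx a (insert b J)) *
        (x a * x b * z (insert a (insert b J))))"
      using ab fin inj_idx by (subst koszul_sign_swap) (auto simp: inj_on_def)
    also have "\<dots> = - ?g b a"
      by (simp add: ac_simps)
    finally show "?g a b = - ?g b a" .
  qed (use finite_E inj_idx in \<open>auto intro: inj_on_subset\<close>)
  finally show ?thesis .
qed

text \<open>If \<open>e\<close> is not in \<open>J\<close>, only the coface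
  \<open>insert e J\<close> survives and its sign is squared. If \<open>e\<close> is in
  \<open>J\<close>, the terms for the other vertices cancel by \<open>koszul_sign_swap\<close>, and
  the term for \<open>e\<close> in the second summand remains.\<close>

lemma boundary_cone:
  assumes J: "J \<subseteq> E" and e: "e \<in> E"
  shows "boundary (cone e z) J + cone e (boundary z) J = x e * z J"
proof (cases "e \<in> J")
  case False
  have "boundary (cone e z) J = (\<Sum>a\<in>E - J. if a = e then x e * z J else 0)"
    unfolding boundary_def cone_def
    using False koszul_sign_square[of idx e J, where 'a = 'a]
    by (intro sum.cong) (auto simp: algebra_simps)
  also have "\<dots> = x e * z J"
    using False e finite_E by simp
  finally show ?thesis using False by (simp add: cone_def)
next
  case True
  define K where "K = J - {e}"
  have K: "J = insert e K" "e \<notin> K" "finite K" "K \<subseteq> E"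
    using True J finite_E finite_subset by (auto simp: K_def)
  let ?t = "\<lambda>a. koszul_sign idx a J * x a * (koszul_sign idx e (insert a K) * z (insert a K))"
  have "boundary (cone e z) J = (\<Sum>a\<in>E - J. ?t a)"
    unfolding boundary_def cone_def
  proof (rule sum.cong)
    fix a assume "a \<in> E - J"
    then have "insert a J - {e} = insert a K" using K by auto
    then show "koszul_sign idx a J * x a * (if e \<in> insert a J
        then koszul_sign idx e (insert a J - {e}) * z (insert a J - {e}) else 0) = ?t a"
      using K by simp
  qed simp
  moreover have "cone e (boundary z) J =
      koszul_sign idx e K * (\<Sum>a\<in>E - K. koszul_sign idx a K * x a * z (insert a K))"
    using True by (simp add: cone_def boundary_def flip: K_def)
  moreover have "E - K = insert e (E - J)" using K e by auto
  then have "(\<Sum>a\<in>E - K. koszul_sign idx a K * x a * z (insert a K)) =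
      koszul_sign idx e K * x e * z J +
      (\<Sum>a\<in>E - J. koszul_sign idx a K * x a * z (insert a K))"
    using finite_E \<open>e \<in> J\<close> by (simp add: sum.insert flip: K(1))
  moreover have "(\<Sum>a\<in>E - J. ?t a) =
      (\<Sum>a\<in>E - J. - (koszul_sign idx e K * (koszul_sign idx a K * x a * z (insert a K))))"
  proof (rule sum.cong)
    fix a assume a: "a \<in> E - J"
    then have "a \<in> E" "a \<noteq> e" unfolding K(1) by blast+
    then have "idx a \<noteq> idx e" using inj_onD[OF inj_idx] e by metis
    from koszul_sign_swap[OF K(3) _ K(2) this, where 'a = 'a]
    have sw: "koszul_sign idx e K * koszul_sign idx a J =
        - (koszul_sign idx a K * koszul_sign idx e (insert a K) :: 'a)"
      using a by (simp add: K(1))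
    have "koszul_sign idx a J = koszul_sign idx e K * (koszul_sign idx e K * koszul_sign idx a J :: 'a)"
      by (simp add: koszul_sign_square flip: mult.assoc)
    also have "\<dots> = - (koszul_sign idx e K * koszul_sign idx a K * koszul_sign idx e (insert a K))"
      by (simp add: sw mult.assoc)
    finally have "?t a = - (koszul_sign idx e K * koszul_sign idx a K * x a * z (insert a K) *
        (koszul_sign idx e (insert a K) * koszul_sign idx e (insert a K)))"
      by (simp add: ac_simps)
    then show "?t a = - (koszul_sign idx e K * (koszul_sign idx a K * x a * z (insert a K)))"
      by (simp add: koszul_sign_square mult.assoc)
  qed simp
  ultimately show ?thesis
    using koszul_sign_square[of idx e K, where 'a = 'a]
    by (simp add: distrib_left sum_negf sum_distrib_left flip: mult.assoc)
qed

text \<open>Vanishing of the \<open>i\<close>-th Koszul homology with coefficients in the quotient by \<open>N\<close>.\<close>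

definition exact :: "'a set \<Rightarrow> nat \<Rightarrow> bool" where
  "exact N i \<longleftrightarrow> (\<forall>z. (\<forall>J\<subseteq>E. Suc (card J) = i \<longrightarrow> boundary z J \<in> N) \<longrightarrow>
     (\<exists>w. \<forall>J\<subseteq>E. card J = i \<longrightarrow> z J - boundary w J \<in> N))"

lemma exact_above:
  assumes "card E < i"
  shows "exact N i"
proof -
  have "card J \<noteq> i" if "J \<subseteq> E" for J
    using card_mono[OF finite_E that] assms by simp
  then show ?thesis unfolding exact_def by blast
qed

text \<open>Multiplication by \<open>f\<close> is null-homotopic when \<open>f\<close> is a combination of the \<open>x e\<close>, so the
  long exact sequence of multiplication by \<open>f\<close> breaks up into short ones.\<close>

lemma exact_of_extend:
  assumes N: "ideal N" and f: "f = (\<Sum>e\<in>E. x e * h e)"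
    and reg: "\<And>y. f * y \<in> N \<Longrightarrow> y \<in> N"
    and ex: "exact (extend_ideal N f) (Suc i)"
  shows "exact N i"
  unfolding exact_def
proof (intro allI impI)
  fix z assume z: "\<forall>J\<subseteq>E. Suc (card J) = i \<longrightarrow> boundary z J \<in> N"
  \<comment> \<open>The null-homotopy applied to \<open>z\<close>: its boundary is
    \<open>f * z\<close> modulo \<open>N\<close>, so \<open>w\<close> is a cycle modulo
    \<open>N + (f)\<close>.\<close>
  define w where "w J = (\<Sum>e\<in>E. h e * cone e z J)" for J
  have dw: "boundary w J - f * z J \<in> N" if J: "J \<subseteq> E" "card J = i" for J
  proof -
    have "boundary w J = (\<Sum>e\<in>E. h e * boundary (cone e z) J)"
      unfolding w_def by (simp add: boundary_sum boundary_mult)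
    also have "\<dots> = (\<Sum>e\<in>E. h e * (x e * z J - cone e (boundary z) J))"
      by (rule sum.cong) (simp_all add: boundary_cone[OF J(1), symmetric])
    also have "\<dots> = f * z J - (\<Sum>e\<in>E. h e * cone e (boundary z) J)"
      by (simp add: f sum_distrib_left right_diff_distrib sum_subtractf ac_simps)
    finally have eq: "boundary w J - f * z J = 0 - (\<Sum>e\<in>E. h e * cone e (boundary z) J)"
      by simp
    have "h e * cone e (boundary z) J \<in> N" if "e \<in> E" for e
    proof (rule ideal_mult_left[OF N])
      have "boundary z (J - {e}) \<in> N" if "e \<in> J"
        using z J that finite_subset[OF J(1) finite_E] by (metis Diff_subset card_Suc_Diff1 subset_trans)
      then show "cone e (boundary z) J \<in> N"
        unfolding cone_def using ideal_mult_left[OF N] ideal_in_zero[OF N] by auto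
    qed
    then have "(\<Sum>e\<in>E. h e * cone e (boundary z) J) \<in> N" by (rule ideal_sum[OF N])
    from ideal_diff[OF N ideal_in_zero[OF N] this] show ?thesis by (simp only: eq)
  qed
  have "boundary w J \<in> extend_ideal N f" if "J \<subseteq> E" "Suc (card J) = Suc i" for J
    using dw[of J] that unfolding extend_ideal_def
    by (intro CollectI exI[of _ "boundary w J - f * z J"] exI[of _ "z J"]) auto
  then obtain v where v: "\<And>J. J \<subseteq> E \<Longrightarrow> card J = Suc i \<Longrightarrow> w J - boundary v J \<in> extend_ideal N f"
    using ex unfolding exact_def by blast
  have "\<forall>J. \<exists>u. J \<subseteq> E \<longrightarrow> card J = Suc i \<longrightarrow> w J - boundary v J - f * u \<in> N"
    using v by (auto simp: extend_ideal_iff)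
  then obtain u where u: "\<And>J. J \<subseteq> E \<Longrightarrow> card J = Suc i \<Longrightarrow> w J - boundary v J - f * u J \<in> N"
    by metis
  \<comment> \<open>Applying the boundary to \<open>w - boundary v - f * u\<close>, which lies in
    \<open>N\<close>, gives \<open>f * z = f * boundary u\<close> modulo \<open>N\<close>;
    regularity cancels \<open>f\<close>.\<close>
  have "z J - boundary u J \<in> N" if J: "J \<subseteq> E" "card J = i" for J
  proof (rule reg)
    let ?n = "boundary (\<lambda>J. w J - boundary v J - f * u J) J"
    have "?n \<in> N" using J u by (intro boundary_in_ideal[OF N]) auto
    moreover have "?n = boundary w J - f * boundary u J"
      by (simp add: boundary_diff boundary_mult boundary_boundary[OF J(1)])
    ultimately have "(boundary w J - f * boundary u J) - (boundary w J - f * z J) \<in> N"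
      using ideal_diff[OF N _ dw[OF J]] by (simp only:)
    then show "f * (z J - boundary u J) \<in> N" by (simp add: right_diff_distrib)
  qed
  then show "\<exists>u. \<forall>J\<subseteq>E. card J = i \<longrightarrow> z J - boundary u J \<in> N" by blast
qed

text \<open>The connecting map made explicit: a cycle modulo \<open>N + (f)\<close> has boundary
  \<open>f * w\<close> modulo \<open>N\<close>, and \<open>w\<close> is a cycle because
  \<open>f\<close> is regular. If \<open>w\<close> is the boundary of \<open>v\<close>, then
  \<open>z - f * v\<close> is a cycle modulo \<open>N\<close> and bounds in turn.\<close>

lemma exact_extend:
  assumes N: "ideal N" and reg: "\<And>y. f * y \<in> N \<Longrightarrow> y \<in> N"
    and ex: "exact N (Suc i)" "exact N i"
  shows "exact (extend_ideal N f) (Suc i)"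
  unfolding exact_def
proof (intro allI impI)
  fix z assume z: "\<forall>J\<subseteq>E. Suc (card J) = Suc i \<longrightarrow> boundary z J \<in> extend_ideal N f"
  have "\<forall>J. \<exists>w. J \<subseteq> E \<longrightarrow> card J = i \<longrightarrow> boundary z J - f * w \<in> N"
    using z by (auto simp: extend_ideal_iff)
  then obtain w where w: "\<And>J. J \<subseteq> E \<Longrightarrow> card J = i \<Longrightarrow> boundary z J - f * w J \<in> N"
    by metis
  have "boundary w J \<in> N" if J: "J \<subseteq> E" "Suc (card J) = i" for J
  proof (rule reg)
    have "boundary (\<lambda>J. boundary z J - f * w J) J \<in> N"
      using J w by (intro boundary_in_ideal[OF N]) auto
    then have "0 - f * boundary w J \<in> N"
      by (simp add: boundary_diff boundary_mult boundary_boundary[OF J(1)])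
    from ideal_diff[OF N ideal_in_zero[OF N] this] show "f * boundary w J \<in> N" by simp
  qed
  then obtain v where v: "\<And>J. J \<subseteq> E \<Longrightarrow> card J = i \<Longrightarrow> w J - boundary v J \<in> N"
    using ex(2) unfolding exact_def by blast
  have "boundary (\<lambda>J. z J - f * v J) J \<in> N" if J: "J \<subseteq> E" "Suc (card J) = Suc i" for J
  proof -
    have "boundary (\<lambda>J. z J - f * v J) J = (boundary z J - f * w J) + f * (w J - boundary v J)"
      by (simp add: boundary_diff boundary_mult algebra_simps)
    then show ?thesis
      using w[of J] v[of J] J ideal_in_add[OF N] ideal_mult_left[OF N] by simp
  qed
  then obtain u where u: "\<And>J. J \<subseteq> E \<Longrightarrow> card J = Suc i \<Longrightarrow> z J - f * v J - boundary u J \<in> N"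
    using ex(1)[unfolded exact_def, rule_format, of "\<lambda>J. z J - f * v J"] by blast
  have "z J - boundary u J \<in> extend_ideal N f" if "J \<subseteq> E" "card J = Suc i" for J
    using u[OF that] unfolding extend_ideal_def
    by (intro CollectI exI[of _ "z J - f * v J - boundary u J"] exI[of _ "v J"]) simp
  then show "\<exists>u. \<forall>J\<subseteq>E. card J = Suc i \<longrightarrow> z J - boundary u J \<in> extend_ideal N f" by blast
qed

text \<open>There are no chains above \<open>E\<close>, so exactness in the top index says that
  every top cycle is zero modulo \<open>N\<close>; an element killed by all \<open>x e\<close> is
  such a cycle.\<close>

lemma exact_top:
  assumes "ideal N" "exact N (card E)" "\<And>e. e \<in> E \<Longrightarrow> x e * y \<in> N"
  shows "y \<in> N"
proof -
  have "boundary (\<lambda>J. y) J \<in> N" for J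
    unfolding boundary_def
  proof (rule ideal_sum[OF assms(1)])
    fix e assume "e \<in> E - J"
    then show "koszul_sign idx e J * x e * y \<in> N"
      using ideal_mult_left[OF assms(1) assms(3)] by (simp add: mult.assoc)
  qed
  then obtain w where "\<And>J. J \<subseteq> E \<Longrightarrow> card J = card E \<Longrightarrow> y - boundary w J \<in> N"
    using assms(2)[unfolded exact_def, rule_format, of "\<lambda>J. y"] by blast
  from this[of E] show ?thesis by (simp add: boundary_def)
qed

end

section \<open>The semigroup algebra\<close>

abbreviation monom :: "'s \<Rightarrow> 's \<Rightarrow>\<^sub>0 'k::zero_neq_one" where
  "monom s \<equiv> Poly_Mapping.single s 1"

lemma sum_singles:
  assumes "finite A" "Poly_Mapping.keys p \<subseteq> A"
  shows "(\<Sum>k\<in>A. Poly_Mapping.single k (Poly_Mapping.lookup p k)) = p"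
proof (rule poly_mapping_eqI)
  fix k
  have "Poly_Mapping.lookup (\<Sum>k\<in>A. Poly_Mapping.single k (Poly_Mapping.lookup p k)) k =
      (\<Sum>l\<in>A. if l = k then Poly_Mapping.lookup p k else 0)"
    unfolding lookup_sum by (rule sum.cong) (auto simp: lookup_single)
  also have "\<dots> = Poly_Mapping.lookup p k"
    using assms by (auto simp: in_keys_iff)
  finally show "Poly_Mapping.lookup (\<Sum>k\<in>A. Poly_Mapping.single k (Poly_Mapping.lookup p k)) k =
      Poly_Mapping.lookup p k" .
qed

section \<open>The homomorphism from polynomials to the semigroup algebra\<close>

lemma nat_scale_0: "nat_scale 0 s = 0"
  by (simp add: nat_scale_def)

lemma nat_scale_add: "nat_scale (a + b) s = nat_scale a s + nat_scale b s"
  by (induction b) (simp_all add: nat_scale_def ac_simps)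

lemma exponent_value_superset:
  assumes "finite A" "Poly_Mapping.keys \<alpha> \<subseteq> A"
  shows "exponent_value \<alpha> = (\<Sum>e\<in>A. nat_scale (Poly_Mapping.lookup \<alpha> e) e)"
  unfolding exponent_value_def
  by (rule sum.mono_neutral_left) (use assms in \<open>auto simp: in_keys_iff nat_scale_0\<close>)

lemma exponent_value_add: "exponent_value (\<alpha> + \<beta>) = exponent_value \<alpha> + exponent_value \<beta>"
proof -
  let ?A = "Poly_Mapping.keys \<alpha> \<union> Poly_Mapping.keys \<beta>"
  have "exponent_value (\<alpha> + \<beta>) = (\<Sum>e\<in>?A. nat_scale (Poly_Mapping.lookup (\<alpha> + \<beta>) e) e)"
    by (rule exponent_value_superset) (auto simp: keys_add)
  also have "\<dots> = (\<Sum>e\<in>?A. nat_scale (Poly_Mapping.lookup \<alpha> e) e) +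
      (\<Sum>e\<in>?A. nat_scale (Poly_Mapping.lookup \<beta> e) e)"
    by (simp add: lookup_add nat_scale_add sum.distrib)
  also have "\<dots> = exponent_value \<alpha> + exponent_value \<beta>"
    by (simp add: exponent_value_superset[of ?A])
  finally show ?thesis .
qed

lemma to_semigroup_algebra_superset:
  assumes "finite A" "Poly_Mapping.keys p \<subseteq> A"
  shows "to_semigroup_algebra p =
    (\<Sum>\<alpha>\<in>A. Poly_Mapping.single (exponent_value \<alpha>) (Poly_Mapping.lookup p \<alpha>))"
  unfolding to_semigroup_algebra_def
  by (rule sum.mono_neutral_left) (use assms in \<open>auto simp: in_keys_iff\<close>)

lemma to_semigroup_algebra_add:
  "to_semigroup_algebra (p + q) = to_semigroup_algebra p + to_semigroup_algebra q"
proof -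
  let ?A = "Poly_Mapping.keys p \<union> Poly_Mapping.keys q"
  have "to_semigroup_algebra (p + q) =
      (\<Sum>\<alpha>\<in>?A. Poly_Mapping.single (exponent_value \<alpha>) (Poly_Mapping.lookup (p + q) \<alpha>))"
    by (rule to_semigroup_algebra_superset) (auto simp: keys_add)
  also have "\<dots> = (\<Sum>\<alpha>\<in>?A. Poly_Mapping.single (exponent_value \<alpha>) (Poly_Mapping.lookup p \<alpha>)) +
      (\<Sum>\<alpha>\<in>?A. Poly_Mapping.single (exponent_value \<alpha>) (Poly_Mapping.lookup q \<alpha>))"
    by (simp add: lookup_add single_add sum.distrib)
  also have "\<dots> = to_semigroup_algebra p + to_semigroup_algebra q"
    by (simp add: to_semigroup_algebra_superset[of ?A])
  finally show ?thesis .
qed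

lemma to_semigroup_algebra_single:
  "to_semigroup_algebra (Poly_Mapping.single \<alpha> c) = Poly_Mapping.single (exponent_value \<alpha>) c"
  by (simp add: to_semigroup_algebra_def)

lemma to_semigroup_algebra_0: "to_semigroup_algebra 0 = 0"
  by (simp add: to_semigroup_algebra_def)

lemma to_semigroup_algebra_sum:
  "to_semigroup_algebra (sum f A) = (\<Sum>a\<in>A. to_semigroup_algebra (f a))"
  by (induction A rule: infinite_finite_induct)
    (simp_all add: to_semigroup_algebra_0 to_semigroup_algebra_add)

lemma to_semigroup_algebra_mult:
  "to_semigroup_algebra (p * q) = to_semigroup_algebra p * to_semigroup_algebra q"
proof -
  have "p * q = (\<Sum>\<alpha>\<in>Poly_Mapping.keys p. Poly_Mapping.single \<alpha> (Poly_Mapping.lookup p \<alpha>)) *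
      (\<Sum>\<beta>\<in>Poly_Mapping.keys q. Poly_Mapping.single \<beta> (Poly_Mapping.lookup q \<beta>))"
    by (simp add: sum_singles)
  then show ?thesis
    unfolding to_semigroup_algebra_def[of p] to_semigroup_algebra_def[of q]
    by (simp add: sum_product to_semigroup_algebra_sum to_semigroup_algebra_single
        mult_single exponent_value_add)
qed

section \<open>The polynomial ring on \<open>E\<close> and its ideal of variables\<close>

lemma poly_ring_add: "p \<in> poly_ring E \<Longrightarrow> q \<in> poly_ring E \<Longrightarrow> p + q \<in> poly_ring E"
  using keys_add[of p q] unfolding poly_ring_def by blast

lemma poly_ring_mult:
  assumes "p \<in> poly_ring E" "q \<in> poly_ring E"
  shows "p * q \<in> poly_ring E"
  unfolding poly_ring_def
proof (intro CollectI ballI)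
  fix \<gamma> assume "\<gamma> \<in> Poly_Mapping.keys (p * q)"
  then obtain \<alpha> \<beta> where "\<gamma> = \<alpha> + \<beta>" "\<alpha> \<in> Poly_Mapping.keys p" "\<beta> \<in> Poly_Mapping.keys q"
    using keys_mult[of p q] by blast
  then show "Poly_Mapping.keys \<gamma> \<subseteq> E"
    using assms keys_add[of \<alpha> \<beta>] unfolding poly_ring_def by blast
qed

lemma poly_ring_0: "0 \<in> poly_ring E"
  and poly_ring_1: "1 \<in> poly_ring E"
  and poly_ring_Var: "e \<in> E \<Longrightarrow> Var e \<in> poly_ring E"
  by (simp_all add: poly_ring_def Var_def)

lemma variable_ideal_subset: "variable_ideal E \<subseteq> poly_ring E"
proof
  fix p :: "('a \<Rightarrow>\<^sub>0 nat) \<Rightarrow>\<^sub>0 'b" assume "p \<in> variable_ideal E"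
  then obtain h where h: "\<forall>e\<in>E. h e \<in> poly_ring E" and p: "p = (\<Sum>e\<in>E. Var e * h e)"
    unfolding variable_ideal_def by blast
  have "(\<Sum>e\<in>A. Var e * h e) \<in> poly_ring E" if "A \<subseteq> E" for A
    using that h
    by (induction A rule: infinite_finite_induct)
      (simp_all add: poly_ring_0 poly_ring_add poly_ring_mult poly_ring_Var)
  then show "p \<in> poly_ring E" using p by blast
qed

lemma variable_ideal_add:
  assumes "p \<in> variable_ideal E" "q \<in> variable_ideal E"
  shows "p + q \<in> variable_ideal E"
proof -
  obtain g h where g: "\<forall>e\<in>E. g e \<in> poly_ring E" "p = (\<Sum>e\<in>E. Var e * g e)"
    and h: "\<forall>e\<in>E. h e \<in> poly_ring E" "q = (\<Sum>e\<in>E. Var e * h e)"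
    using assms unfolding variable_ideal_def by blast
  have "p + q = (\<Sum>e\<in>E. Var e * (g e + h e))"
    by (simp add: g h distrib_left sum.distrib)
  moreover have "\<forall>e\<in>E. g e + h e \<in> poly_ring E"
    using g h poly_ring_add by blast
  ultimately show ?thesis
    unfolding variable_ideal_def by (intro CollectI exI[of _ "\<lambda>e. g e + h e"]) simp
qed

lemma variable_ideal_mult:
  assumes "p \<in> variable_ideal E" "q \<in> variable_ideal E"
  shows "p * q \<in> variable_ideal E"
proof -
  obtain g where g: "\<forall>e\<in>E. g e \<in> poly_ring E" "p = (\<Sum>e\<in>E. Var e * g e)"
    using assms(1) unfolding variable_ideal_def by blast
  have "p * q = (\<Sum>e\<in>E. Var e * (g e * q))"
    by (simp add: g sum_distrib_right mult.assoc)
  moreover have "\<forall>e\<in>E. g e * q \<in> poly_ring E"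
    using g(1) assms(2) variable_ideal_subset poly_ring_mult by blast
  ultimately show ?thesis
    unfolding variable_ideal_def by (intro CollectI exI[of _ "\<lambda>e. g e * q"]) simp
qed

lemma Var_in_variable_ideal:
  assumes "finite E" "e \<in> E"
  shows "(Var e :: ('s \<Rightarrow>\<^sub>0 nat) \<Rightarrow>\<^sub>0 'k::field) \<in> variable_ideal E"
proof -
  have "(\<Sum>a\<in>E. Var a * (if a = e then 1 else 0)) = (\<Sum>a\<in>E. if a = e then Var e else (0 :: ('s \<Rightarrow>\<^sub>0 nat) \<Rightarrow>\<^sub>0 'k))"
    by (rule sum.cong) auto
  also have "\<dots> = Var e" using assms by simp
  finally show ?thesis
    unfolding variable_ideal_def
    by (intro CollectI exI[of _ "\<lambda>a. if a = e then 1 else 0"]) (simp add: poly_ring_0 poly_ring_1)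
qed

lemma to_semigroup_algebra_variable_ideal:
  assumes "p \<in> variable_ideal E"
  shows "\<exists>h. to_semigroup_algebra p = (\<Sum>e\<in>E. monom e * h e)"
proof -
  obtain h where "p = (\<Sum>e\<in>E. Var e * h e)"
    using assms unfolding variable_ideal_def by blast
  then have "to_semigroup_algebra p = (\<Sum>e\<in>E. monom e * to_semigroup_algebra (h e))"
    by (simp add: to_semigroup_algebra_sum to_semigroup_algebra_mult to_semigroup_algebra_Var)
  then show ?thesis by (intro exI)
qed

lemma noetherian_constants:
  "noetherian (range (Poly_Mapping.single 0) :: ('s::comm_monoid_add \<Rightarrow>\<^sub>0 'k::field) set)"
  (is "noetherian ?B")
  unfolding noetherian_def
proof (intro allI impI)
  fix K :: "nat \<Rightarrow> ('s \<Rightarrow>\<^sub>0 'k) set"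
  assume K: "(\<forall>n. ideal_in ?B (K n)) \<and> (\<forall>n. K n \<subseteq> K (Suc n))"
  \<comment> \<open>A nonzero constant is invertible among the constants, so each ideal is zero or
    everything and the chain can jump only once.\<close>
  have all: "K n = ?B" if a: "a \<in> K n" "a \<noteq> 0" for n a
  proof -
    have id: "ideal_in ?B (K n)" using K by blast
    obtain c where c: "a = Poly_Mapping.single 0 c"
      using ideal_in_subset[OF id] a(1) by blast
    then have "c \<noteq> 0" using a(2) by auto
    have "Poly_Mapping.single 0 d \<in> K n" for d
    proof -
      have "Poly_Mapping.single 0 (d / c) * a = Poly_Mapping.single 0 d"
        using \<open>c \<noteq> 0\<close> by (simp add: c mult_single)
      then show ?thesis
        using ideal_in_mult[OF id, of "Poly_Mapping.single 0 (d / c)" a] a(1) by simp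
    qed
    then show ?thesis using ideal_in_subset[OF id] by blast
  qed
  have mono: "m \<le> n \<Longrightarrow> K m \<subseteq> K n" for m n
    by (rule lift_Suc_mono_le[of K]) (use K in blast)+
  show "\<exists>M. \<forall>n\<ge>M. K n = K M"
  proof (cases "\<exists>m a. a \<in> K m \<and> a \<noteq> 0")
    case True
    then obtain m a where "a \<in> K m" "a \<noteq> 0" by blast
    then have "K n = ?B" if "n \<ge> m" for n
      using all[of a n] mono[OF that] by blast
    then show ?thesis by (metis order_refl)
  next
    case False
    have "K n = {0}" for n
      using False ideal_in_zero[of ?B "K n"] K by blast
    then show ?thesis by simp
  qed
qed

lemma subring_constants:
  "subring (range (Poly_Mapping.single 0) :: ('s::comm_monoid_add \<Rightarrow>\<^sub>0 'k::field) set)"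
  unfolding subring_def
proof (intro conjI ballI)
  show "1 \<in> range (Poly_Mapping.single 0)" by (metis rangeI single_one)
next
  fix a b :: "'s \<Rightarrow>\<^sub>0 'k"
  assume "a \<in> range (Poly_Mapping.single 0)" "b \<in> range (Poly_Mapping.single 0)"
  then obtain c d where "a = Poly_Mapping.single 0 c" "b = Poly_Mapping.single 0 d" by blast
  then have "a - b = Poly_Mapping.single 0 (c - d)" "a * b = Poly_Mapping.single 0 (c * d)"
    by (simp_all add: single_diff mult_single)
  then show "a - b \<in> range (Poly_Mapping.single 0)" "a * b \<in> range (Poly_Mapping.single 0)" by blast+
qed

text \<open>The monomials of the generators of \<open>S\<close> are adjoined to the constants one at
  a time. The resulting Noetherian subring contains all monomials and scalars, hence
  everything.\<close>

lemma noetherian_semigroup_algebra: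
  assumes "finitely_generated TYPE('s::comm_monoid_add)"
  shows "noetherian (UNIV :: ('s \<Rightarrow>\<^sub>0 'k::field) set)"
proof -
  obtain A :: "'s set" where A: "finite A"
    "\<And>s. \<exists>c :: 's \<Rightarrow> nat. s = (\<Sum>a\<in>A. nat_scale (c a) a)"
    using assms unfolding finitely_generated_def by blast
  have "\<exists>B :: ('s \<Rightarrow>\<^sub>0 'k) set. subring B \<and> noetherian B \<and>
      range (Poly_Mapping.single 0) \<subseteq> B \<and> monom ` A \<subseteq> B"
    using A(1)
  proof (induction A rule: finite_induct)
    case empty
    then show ?case using noetherian_constants subring_constants by blast
  next
    case (insert a A)
    then obtain B :: "('s \<Rightarrow>\<^sub>0 'k) set" where B: "subring B" "noetherian B"
      "range (Poly_Mapping.single 0) \<subseteq> B" "monom ` A \<subseteq> B" by blast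
    let ?C = "adjoin B (monom a)"
    have "range (Poly_Mapping.single 0) \<subseteq> ?C" "monom ` insert a A \<subseteq> ?C"
      using B(3,4) subset_adjoin[OF B(1), of "monom a"] gen_in_adjoin[OF B(1), of "monom a"] by auto
    then show ?case
      using subring_adjoin[OF B(1)] noetherian_adjoin[OF B(1,2)] by blast
  qed
  then obtain B :: "('s \<Rightarrow>\<^sub>0 'k) set" where B: "subring B" "noetherian B"
    "range (Poly_Mapping.single 0) \<subseteq> B" "monom ` A \<subseteq> B" by blast
  have one: "1 \<in> B" using B(1) by (simp add: subring_def)
  have add: "monom (s + t) \<in> B" if "monom s \<in> B" "monom t \<in> B" for s t
    using subring_mult[OF B(1) that] by (simp add: mult_single)
  have scale: "monom (nat_scale k a) \<in> B" if "a \<in> A" for k a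
  proof (induction k)
    case 0
    then show ?case using one by (simp add: nat_scale_0)
  next
    case (Suc k)
    have "nat_scale (Suc k) a = nat_scale k a + a" by (simp add: nat_scale_def ac_simps)
    then show ?case using add[OF Suc] B(4) that by auto
  qed
  have sums: "monom (\<Sum>a\<in>F. nat_scale (c a) a) \<in> B" if "finite F" "F \<subseteq> A" for F and c :: "'s \<Rightarrow> nat"
    using that by (induction F rule: finite_induct) (auto simp: one intro!: add scale)
  have all: "monom s \<in> B" for s
    using A(2)[of s] sums[OF A(1) order_refl] by auto
  have singles: "Poly_Mapping.single s c \<in> B" for s c
  proof -
    have "Poly_Mapping.single 0 c * monom s \<in> B"
      using subring_mult[OF B(1)] B(3) all[of s] by blast
    then show ?thesis by (simp add: mult_single)
  qed
  have "(\<Sum>k\<in>F. Poly_Mapping.single k (Poly_Mapping.lookup p k)) \<in> B" if "finite F" for F p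
    using that by (induction F rule: finite_induct)
      (simp_all add: subring_zero[OF B(1)] subring_add[OF B(1)] singles)
  then have "p \<in> B" for p
    using sum_singles[of "Poly_Mapping.keys p" p] by (metis finite_keys order_refl)
  then have "B = UNIV" by blast
  then show ?thesis using B(2) by simp
qed

section \<open>Regular sequences and exactness\<close>

lemma submodule_multiples_0: "submodule_multiples act fs 0 = {0}"
  by (simp add: submodule_multiples_def)

lemma submodule_multiples_Suc:
  "submodule_multiples poly_act fs (Suc i) =
     extend_ideal (submodule_multiples poly_act fs i) (to_semigroup_algebra (fs ! i))"
proof
  show "submodule_multiples poly_act fs (Suc i) \<subseteq>
      extend_ideal (submodule_multiples poly_act fs i) (to_semigroup_algebra (fs ! i))"
    unfolding submodule_multiples_def extend_ideal_def by (auto simp: poly_act_def)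
  show "extend_ideal (submodule_multiples poly_act fs i) (to_semigroup_algebra (fs ! i)) \<subseteq>
      submodule_multiples poly_act fs (Suc i)"
  proof
    fix y assume "y \<in> extend_ideal (submodule_multiples poly_act fs i) (to_semigroup_algebra (fs ! i))"
    then obtain g a where "y = (\<Sum>j<i. poly_act (fs ! j) (g j)) + to_semigroup_algebra (fs ! i) * a"
      unfolding submodule_multiples_def extend_ideal_def by blast
    then have "y = (\<Sum>j<Suc i. poly_act (fs ! j) ((g(i := a)) j))"
      by (simp add: poly_act_def)
    then show "y \<in> submodule_multiples poly_act fs (Suc i)"
      unfolding submodule_multiples_def by blast
  qed
qed

lemma ideal_submodule_multiples: "ideal (submodule_multiples poly_act fs i)"
proof (induction i)
  case 0
  then show ?case by (simp add: submodule_multiples_0 ideal_in_def)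
next
  case (Suc i)
  then show ?case unfolding submodule_multiples_Suc by (rule ideal_extend)
qed

lemma submodule_multiples_append:
  "i \<le> length fs \<Longrightarrow> submodule_multiples act (fs @ gs) i = submodule_multiples act fs i"
  unfolding submodule_multiples_def by (auto simp: nth_append)

text \<open>By positivity \<open>0 = e + b\<close> forces \<open>e = 0\<close>, so multiples of
  \<open>monom e\<close> have no constant term. This keeps 1 out of the submodule, as the last
  clause of a regular sequence requires.\<close>

lemma submodule_multiples_proper:
  assumes pos: "positive TYPE('s::comm_monoid_add)" and "0 \<notin> E"
    and fs: "set fs \<subseteq> (variable_ideal E :: (('s \<Rightarrow>\<^sub>0 nat) \<Rightarrow>\<^sub>0 'k::field) set)"
    and "i \<le> length fs" "y \<in> submodule_multiples poly_act fs i"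
  shows "Poly_Mapping.lookup y 0 = 0"
proof -
  obtain g where y: "y = (\<Sum>j<i. poly_act (fs ! j) (g j))"
    using assms(5) unfolding submodule_multiples_def by blast
  have "Poly_Mapping.lookup (poly_act (fs ! j) (g j)) 0 = 0" if "j < i" for j
  proof -
    have "fs ! j \<in> variable_ideal E" using fs that assms(4) by auto
    then obtain h where h: "to_semigroup_algebra (fs ! j) = (\<Sum>e\<in>E. monom e * h e)"
      using to_semigroup_algebra_variable_ideal by blast
    have "Poly_Mapping.lookup (monom e * (h e * g j)) 0 = 0" if "e \<in> E" for e
    proof (rule ccontr)
      assume "Poly_Mapping.lookup (monom e * (h e * g j)) 0 \<noteq> 0"
      then have "0 \<in> Poly_Mapping.keys (monom e * (h e * g j))" by (simp add: in_keys_iff)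
      then obtain b where "0 = e + b"
        using keys_mult[of "monom e" "h e * g j"] by auto
      then have "e = 0" using pos unfolding positive_def by metis
      with that \<open>0 \<notin> E\<close> show False by blast
    qed
    then show ?thesis
      by (simp add: poly_act_def h sum_distrib_right lookup_sum mult.assoc)
  qed
  then show ?thesis by (simp add: y lookup_sum)
qed

context
  fixes E :: "'s::comm_monoid_add set" and idx :: "'s \<Rightarrow> nat"
    and exact :: "('s \<Rightarrow>\<^sub>0 'k::field) set \<Rightarrow> nat \<Rightarrow> bool"
  assumes fin: "finite E" and inj: "inj_on idx E"
  defines "exact \<equiv> koszul.exact E idx (\<lambda>e. monom e)"
begin

interpretation K: koszul E idx "\<lambda>e. monom e :: 's \<Rightarrow>\<^sub>0 'k"
  using fin inj by unfold_locales

text \<open>By \<open>exact_of_extend\<close> each term of the sequence moves a non-vanishing index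
  up by one, and no homology is left above \<open>card E\<close>.\<close>

lemma length_regular_sequence_le:
  assumes "regular_sequence poly_act fs"
    and fs: "set fs \<subseteq> (variable_ideal E :: (('s \<Rightarrow>\<^sub>0 nat) \<Rightarrow>\<^sub>0 'k) set)"
    and "\<not> exact {0} i"
  shows "length fs + i \<le> card E"
proof -
  have "\<not> exact (submodule_multiples poly_act fs j) (i + j)" if "j \<le> length fs" for j
    using that
  proof (induction j)
    case 0
    then show ?case using assms(3) by (simp add: submodule_multiples_0)
  next
    case (Suc j)
    have "fs ! j \<in> variable_ideal E" using fs Suc.prems by auto
    then obtain h where h: "to_semigroup_algebra (fs ! j) = (\<Sum>e\<in>E. monom e * h e)"
      using to_semigroup_algebra_variable_ideal by blast
    have reg: "y \<in> submodule_multiples poly_act fs j"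
      if "to_semigroup_algebra (fs ! j) * y \<in> submodule_multiples poly_act fs j" for y
      using assms(1) that Suc.prems unfolding regular_sequence_def poly_act_def by auto
    show ?case
    proof
      assume "exact (submodule_multiples poly_act fs (Suc j)) (i + Suc j)"
      then have "exact (extend_ideal (submodule_multiples poly_act fs j)
          (to_semigroup_algebra (fs ! j))) (Suc (i + j))"
        by (simp add: submodule_multiples_Suc)
      then have "exact (submodule_multiples poly_act fs j) (i + j)"
        unfolding exact_def by (intro K.exact_of_extend[OF ideal_submodule_multiples h]) (rule reg)
      with Suc show False by simp
    qed
  qed
  from this[of "length fs"] have "\<not> card E < i + length fs"
    using K.exact_above unfolding exact_def by blast
  then show ?thesis by simp
qed

text \<open>Each division costs one index of vanishing: after \<open>q\<close> steps homology
  vanishes above \<open>#E + q - p\<close>, stated with sums to avoid truncated subtraction. While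
  \<open>q < p\<close> this range includes the top index, where \<open>exact_top\<close> supplies
  what \<open>exists_regular_element\<close> asks for.\<close>

lemma exists_regular_sequence:
  assumes noeth: "noetherian (UNIV :: ('s \<Rightarrow>\<^sub>0 'k) set)"
    and pos: "positive TYPE('s)" and "0 \<notin> E"
    and ex: "\<And>j. card E < j + p \<Longrightarrow> exact {0} j"
    and "p \<le> card E"
  shows "\<exists>fs. length fs = p \<and> set fs \<subseteq> (variable_ideal E :: (('s \<Rightarrow>\<^sub>0 nat) \<Rightarrow>\<^sub>0 'k) set) \<and>
    regular_sequence poly_act fs"
proof -
  have "\<exists>fs. length fs = q \<and> set fs \<subseteq> (variable_ideal E :: (('s \<Rightarrow>\<^sub>0 nat) \<Rightarrow>\<^sub>0 'k) set) \<and>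
      regular_sequence poly_act fs \<and>
      (\<forall>j. card E + q < j + p \<longrightarrow> exact (submodule_multiples poly_act fs q) j)" if "q \<le> p" for q
    using that
  proof (induction q)
    case 0
    have "{0} \<noteq> (UNIV :: ('s \<Rightarrow>\<^sub>0 'k) set)"
      using one_neq_zero[where 'a = "'s \<Rightarrow>\<^sub>0 'k"] by (metis UNIV_I singletonD)
    then have "regular_sequence poly_act ([] :: (('s \<Rightarrow>\<^sub>0 nat) \<Rightarrow>\<^sub>0 'k) list)"
      unfolding regular_sequence_def by (simp only: list.size submodule_multiples_0) simp
    then show ?case
      using ex by (intro exI[of _ "[]"]) (simp add: submodule_multiples_0)
  next
    case (Suc q)
    then have "q \<le> p" by simp
    from Suc.IH[OF this] obtain fs where fs: "length fs = q"
      "set fs \<subseteq> (variable_ideal E :: (('s \<Rightarrow>\<^sub>0 nat) \<Rightarrow>\<^sub>0 'k) set)"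
      "regular_sequence poly_act fs"
      and exq: "\<And>j. card E + q < j + p \<Longrightarrow> exact (submodule_multiples poly_act fs q) j"
      by blast
    define N where "N = submodule_multiples poly_act fs q"
    have N: "ideal N" unfolding N_def by (rule ideal_submodule_multiples)
    let ?F = "to_semigroup_algebra ` (variable_ideal E :: (('s \<Rightarrow>\<^sub>0 nat) \<Rightarrow>\<^sub>0 'k) set)"
    have "\<exists>f\<in>?F. \<forall>y. f * y \<in> N \<longrightarrow> y \<in> N"
    proof (rule exists_regular_element[OF noeth N])
      fix a b assume "a \<in> ?F" "b \<in> ?F"
      then obtain p q where "p \<in> variable_ideal E" "q \<in> variable_ideal E"
        and ab: "a = to_semigroup_algebra p" "b = to_semigroup_algebra q" by blast
      then have "p + q \<in> variable_ideal E" "p * q \<in> variable_ideal E"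
        using variable_ideal_add variable_ideal_mult by blast+
      then show "a + b \<in> ?F" "a * b \<in> ?F"
        unfolding ab to_semigroup_algebra_add[symmetric] to_semigroup_algebra_mult[symmetric]
        by blast+
    next
      have "(0 :: ('s \<Rightarrow>\<^sub>0 nat) \<Rightarrow>\<^sub>0 'k) \<in> variable_ideal E"
        unfolding variable_ideal_def
        by (intro CollectI exI[of _ "\<lambda>_. 0"]) (simp add: poly_ring_0)
      then show "?F \<noteq> {}" by blast
    next
      fix y assume y: "\<And>a. a \<in> ?F \<Longrightarrow> a * y \<in> N"
      have "monom e * y \<in> N" if "e \<in> E" for e
        using y[OF imageI[OF Var_in_variable_ideal[OF fin that]]]
        by (simp add: to_semigroup_algebra_Var)
      moreover have "exact N (card E)"
        unfolding N_def using Suc.prems by (intro exq) simp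
      ultimately show "y \<in> N"
        using K.exact_top[OF N] unfolding exact_def by blast
    qed
    then obtain f where f: "f \<in> variable_ideal E"
      and reg: "\<And>y. to_semigroup_algebra f * y \<in> N \<Longrightarrow> y \<in> N" by blast
    let ?fs = "fs @ [f]"
    have prefix: "submodule_multiples poly_act ?fs i = submodule_multiples poly_act fs i"
      if "i \<le> q" for i
      using submodule_multiples_append[of i fs poly_act "[f]"] that fs(1) by simp
    have last: "?fs ! q = f" using fs(1) by (auto simp: nth_append)
    have set: "set ?fs \<subseteq> variable_ideal E" using fs(2) f by simp
    have "submodule_multiples poly_act ?fs (Suc q) = extend_ideal N (to_semigroup_algebra f)"
      unfolding submodule_multiples_Suc by (simp add: prefix last N_def)
    moreover have "exact (extend_ideal N (to_semigroup_algebra f)) j" if j: "card E + Suc q < j + p" for j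
    proof -
      obtain i where i: "j = Suc i"
        using j assms(5) by (cases j) auto
      then have "exact N (Suc i)" "exact N i"
        unfolding N_def using j by (intro exq; simp)+
      then show ?thesis
        unfolding exact_def i by (intro K.exact_extend[OF N reg])
    qed
    moreover have "regular_sequence poly_act ?fs"
      unfolding regular_sequence_def
    proof (intro conjI allI impI)
      fix i y assume i: "i < length ?fs"
        and y: "poly_act (?fs ! i) y \<in> submodule_multiples poly_act ?fs i"
      show "y \<in> submodule_multiples poly_act ?fs i"
      proof (cases "i < q")
        case True
        then show ?thesis
          using y fs(1,3) prefix[of i] unfolding regular_sequence_def by (simp add: nth_append)
      next
        case False
        then have "i = q" using i fs(1) by simp
        then show ?thesis
          using y fs(1) prefix[of q] reg[of y] by (simp add: last N_def poly_act_def)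
      qed
    next
      have "Poly_Mapping.lookup (1 :: 's \<Rightarrow>\<^sub>0 'k) 0 \<noteq> 0" by simp
      then show "submodule_multiples poly_act ?fs (length ?fs) \<noteq> UNIV"
        using submodule_multiples_proper[OF pos \<open>0 \<notin> E\<close> set order_refl, of 1] by auto
    qed
    ultimately show ?case
      using fs(1) set by (intro exI[of _ ?fs]) simp
  qed
  from this[of p] show ?thesis by blast
qed

end

section \<open>Koszul homology of the semigroup algebra in each degree\<close>

context
  assumes canc: "cancelative TYPE('s::comm_monoid_add)"
begin

lemma add_left_cancel_semigroup: "(a :: 's) + b = a + c \<longleftrightarrow> b = c"
  using canc unfolding cancelative_def by (metis add.commute)

text \<open>Cancellation embeds \<open>S\<close> in its group of differences, so the conditions on
  faces and supports become divisibility in \<open>S\<close>.\<close>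

lemma in_semigroup_diff: "in_semigroup (to_group (m :: 's) - to_group n) \<longleftrightarrow> (\<exists>k. m = n + k)"
proof -
  have "in_semigroup (to_group m - to_group n) \<longleftrightarrow> (\<exists>k. to_group m - to_group n = to_group k)"
    unfolding in_semigroup_def by blast
  also have "\<dots> \<longleftrightarrow> (\<exists>k. to_group m = to_group (n + k))"
    by (simp add: to_group_add diff_eq_eq add.commute)
  finally show ?thesis by (simp add: to_group_inject[OF canc])
qed

lemma complex_of_iff: "J \<in> complex_of E (m :: 's) \<longleftrightarrow> J \<subseteq> E \<and> (\<exists>k. m = \<Sum>J + k)"
  by (simp add: complex_of_def in_semigroup_diff)

lemma supp_iff: "e \<in> supp E (m :: 's) \<longleftrightarrow> e \<in> E \<and> (\<exists>k. m = e + k)"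
  by (simp add: supp_def in_semigroup_diff)

lemma D_face_iff: "(m :: 's) \<in> D_face E J \<longleftrightarrow> J \<subseteq> supp E m \<and> (\<nexists>k. m = \<Sum>J + k)"
  by (simp add: D_face_def in_semigroup_diff)

lemma sum_mono_below:
  assumes "finite J" "I \<subseteq> J"
  shows "\<exists>k. (\<Sum>J :: 's) = \<Sum>I + k"
  using sum.subset_diff[OF assms(2,1), of "\<lambda>x. x"] by (metis add.commute)

lemma complex_of_subset:
  assumes "finite E" "J \<in> complex_of E (m :: 's)" "I \<subseteq> J"
  shows "I \<in> complex_of E m"
proof -
  obtain k where k: "m = \<Sum>J + k" "J \<subseteq> E" using assms(2) by (auto simp: complex_of_iff)
  obtain l where "\<Sum>J = \<Sum>I + l"
    using sum_mono_below[OF finite_subset[OF k(2) assms(1)] assms(3)] by blast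
  then have "m = \<Sum>I + (l + k)" by (simp add: k(1) ac_simps)
  then show ?thesis using assms(3) k(2) by (auto simp: complex_of_iff)
qed

lemma face_subset_supp:
  assumes "finite E" "J \<in> complex_of E (m :: 's)"
  shows "J \<subseteq> supp E m"
proof
  fix e assume "e \<in> J"
  then have "{e} \<in> complex_of E m" using complex_of_subset[OF assms] by blast
  then show "e \<in> supp E m" by (auto simp: complex_of_iff supp_iff)
qed

text \<open>By cancellation, translation by \<open>s\<close> is injective, so multiplying by a
  monomial moves coefficients without merging any.\<close>

lemma lookup_monom_mult:
  "Poly_Mapping.lookup (monom s * f :: 's \<Rightarrow>\<^sub>0 'k::field) (s + k) = Poly_Mapping.lookup f k"
proof -
  have "monom s * f =
      monom s * (\<Sum>l\<in>Poly_Mapping.keys f. Poly_Mapping.single l (Poly_Mapping.lookup f l))"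
    by (simp add: sum_singles)
  also have "\<dots> = (\<Sum>l\<in>Poly_Mapping.keys f. Poly_Mapping.single (s + l) (Poly_Mapping.lookup f l))"
    by (simp add: sum_distrib_left mult_single)
  finally have "Poly_Mapping.lookup (monom s * f) (s + k) =
      (\<Sum>l\<in>Poly_Mapping.keys f. Poly_Mapping.lookup (Poly_Mapping.single (s + l) (Poly_Mapping.lookup f l)) (s + k))"
    by (simp only: lookup_sum)
  also have "\<dots> = (\<Sum>l\<in>Poly_Mapping.keys f. if l = k then Poly_Mapping.lookup f k else 0)"
    by (rule sum.cong) (auto simp: lookup_single add_left_cancel_semigroup when_def)
  also have "\<dots> = Poly_Mapping.lookup f k" by (simp add: in_keys_iff)
  finally show ?thesis .
qed

lemma lookup_monom_mult_outside:
  assumes "\<nexists>k. m = s + k"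
  shows "Poly_Mapping.lookup (monom s * f :: 's \<Rightarrow>\<^sub>0 'k::field) m = 0"
proof (rule ccontr)
  assume "Poly_Mapping.lookup (monom s * f) m \<noteq> 0"
  then have "m \<in> Poly_Mapping.keys (monom s * f)" by (simp add: in_keys_iff)
  then show False using keys_mult[of "monom s" f] assms by auto
qed

lemma eq_of_lookup_monom_mult:
  assumes "\<And>m. Poly_Mapping.lookup (monom s * f :: 's \<Rightarrow>\<^sub>0 'k::field) m = Poly_Mapping.lookup (monom s * g) m"
  shows "f = g"
  by (rule poly_mapping_eqI) (metis assms lookup_monom_mult)

context
  fixes E :: "'s set" and idx :: "'s \<Rightarrow> nat"
    and exact :: "('s \<Rightarrow>\<^sub>0 'k::field) set \<Rightarrow> nat \<Rightarrow> bool"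
  assumes fin: "finite E" and inj: "inj_on idx E"
  defines "exact \<equiv> koszul.exact E idx (\<lambda>e. monom e)"
begin

interpretation K: koszul E idx "\<lambda>e. monom e :: 's \<Rightarrow>\<^sub>0 'k"
  using fin inj by unfold_locales

interpretation C: koszul E idx "\<lambda>_. 1 :: 'k"
  using fin inj by unfold_locales

text \<open>The degree \<open>m\<close> part of the Koszul complex is the chain complex of \<open>complex_of E m\<close>:
  a chain \<open>z\<close> has in degree \<open>m\<close> the coefficient at \<open>J\<close> given by the coefficient of \<open>t^(m - e_J)\<close>
  in \<open>z J\<close>, which is that of \<open>t^m\<close> in \<open>t^e_J * z J\<close>.\<close>

definition degree_part :: "'s \<Rightarrow> ('s set \<Rightarrow> 's \<Rightarrow>\<^sub>0 'k) \<Rightarrow> 's set \<Rightarrow> 'k" where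
  "degree_part m z J = Poly_Mapping.lookup (monom (\<Sum>J) * z J) m"

lemma lookup_koszul_sign_mult:
  "Poly_Mapping.lookup (koszul_sign idx e J * f :: 's \<Rightarrow>\<^sub>0 'k) m =
     koszul_sign idx e J * Poly_Mapping.lookup f m"
  by (cases "even (card {a \<in> J. idx a < idx e})") (simp_all add: koszul_sign_def)

lemma degree_part_boundary:
  assumes "J \<subseteq> E"
  shows "degree_part m (K.boundary z) J = C.boundary (degree_part m z) J"
proof -
  have "monom (\<Sum>J) * K.boundary z J =
      (\<Sum>e\<in>E - J. koszul_sign idx e J * (monom (\<Sum>(insert e J)) * z (insert e J)))"
    unfolding K.boundary_def sum_distrib_left
  proof (rule sum.cong)
    fix e assume "e \<in> E - J"
    then have "\<Sum>(insert e J) = e + \<Sum>J"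
      using finite_subset[OF assms fin] by simp
    then have "monom (\<Sum>(insert e J)) = monom (\<Sum>J) * (monom e :: 's \<Rightarrow>\<^sub>0 'k)"
      by (simp add: mult_single add.commute)
    then show "monom (\<Sum>J) * (koszul_sign idx e J * monom e * z (insert e J)) =
        koszul_sign idx e J * (monom (\<Sum>(insert e J)) * z (insert e J))"
      by (simp only: ac_simps)
  qed simp
  then show ?thesis
    unfolding degree_part_def C.boundary_def
    by (simp only: lookup_sum lookup_koszul_sign_mult mult_1_right)
qed

lemma degree_part_eq_0: "J \<subseteq> E \<Longrightarrow> J \<notin> complex_of E m \<Longrightarrow> degree_part m z J = 0"
  unfolding degree_part_def complex_of_iff by (intro lookup_monom_mult_outside) blast

lemma eq_of_degree_part: "(\<And>m. degree_part m y J = degree_part m z J) \<Longrightarrow> y J = z J"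
  unfolding degree_part_def by (rule eq_of_lookup_monom_mult)

text \<open>The way back from degrees to the algebra: a coefficient at a face \<open>J\<close> of
  degree \<open>m\<close> belongs to the exponent \<open>m - e_J\<close>, which lies in
  \<open>S\<close>, and finiteness makes the prescribed coefficients an element of the
  algebra.\<close>

lemma exists_chain:
  assumes W: "\<And>m. W m J \<noteq> 0 \<Longrightarrow> J \<in> complex_of E m" and fin_W: "finite {m. W m J \<noteq> 0}"
  shows "\<exists>f. \<forall>m. Poly_Mapping.lookup (monom (\<Sum>J) * f :: 's \<Rightarrow>\<^sub>0 'k) m = W m J"
proof -
  have "inj (\<lambda>k. \<Sum>J + k)" by (simp add: inj_def add_left_cancel_semigroup)
  then have "finite ((\<lambda>k. \<Sum>J + k) -` {m. W m J \<noteq> 0})" by (rule finite_vimageI[OF fin_W])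
  then have "finite {k. W (\<Sum>J + k) J \<noteq> 0}" by (simp add: vimage_def)
  then have look: "Poly_Mapping.lookup (Abs_poly_mapping (\<lambda>k. W (\<Sum>J + k) J)) k = W (\<Sum>J + k) J" for k
    by simp
  have "Poly_Mapping.lookup (monom (\<Sum>J) * Abs_poly_mapping (\<lambda>k. W (\<Sum>J + k) J)) m = W m J" for m
  proof (cases "\<exists>k. m = \<Sum>J + k")
    case True
    then show ?thesis using look by (auto simp: lookup_monom_mult)
  next
    case False
    then have "W m J = 0" using W[of m] by (auto simp: complex_of_iff)
    then show ?thesis using lookup_monom_mult_outside[OF False] by simp
  qed
  then show ?thesis by blast
qed

text \<open>In degree \<open>m\<close> any vertex of \<open>complex_of E m\<close> serves as the apex of a contracting cone.\<close>

lemma exact_zero: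
  assumes "0 < i"
    and full: "\<And>J. J \<subseteq> E \<Longrightarrow> card J = Suc i \<Longrightarrow> D_face E J = {}"
  shows "exact {0} i"
  unfolding exact_def K.exact_def
proof (intro allI impI)
  fix z :: "'s set \<Rightarrow> 's \<Rightarrow>\<^sub>0 'k"
  assume z: "\<forall>J\<subseteq>E. Suc (card J) = i \<longrightarrow> K.boundary z J \<in> {0}"
  have cyc: "C.boundary (degree_part m z) J = 0" if J: "J \<subseteq> E" "Suc (card J) = i" for m J
  proof -
    have "K.boundary z J = 0" using z J by blast
    then show ?thesis
      using degree_part_boundary[OF J(1), of m z] by (simp add: degree_part_def)
  qed
  define apex where "apex m = (SOME e. e \<in> supp E m)" for m
  \<comment> \<open>The apex varies with the degree. Where there is no vertex there is no face of
    size \<open>i > 0\<close> either, and the zero chain serves.\<close>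
  define W where "W m = (if supp E m = {} then (\<lambda>_. 0) else C.cone (apex m) (degree_part m z))" for m
  have apex: "apex m \<in> supp E m" if "supp E m \<noteq> {}" for m
    unfolding apex_def using that some_in_eq by blast
  have W_nonzero: "apex m \<in> J \<and> supp E m \<noteq> {} \<and> degree_part m z (J - {apex m}) \<noteq> 0"
    if "W m J \<noteq> 0" for m J
    using that by (auto simp: W_def C.cone_def split: if_splits)
  have "\<exists>f. \<forall>m. Poly_Mapping.lookup (monom (\<Sum>J) * f :: 's \<Rightarrow>\<^sub>0 'k) m = W m J"
    if J: "J \<subseteq> E" "card J = Suc i" for J
  proof (rule exists_chain)
    fix m assume "W m J \<noteq> 0"
    note nz = W_nonzero[OF this]
    \<comment> \<open>A face of size \<open>i\<close> together with the apex lies in the support,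
      and the emptiness of \<open>D_face E J\<close> turns this into a face.\<close>
    then have "J - {apex m} \<in> complex_of E m"
      using degree_part_eq_0[of "J - {apex m}" m z] J(1) by blast
    then have "J \<subseteq> supp E m"
      using face_subset_supp[OF fin] apex nz by blast
    then show "J \<in> complex_of E m"
      using full[OF J] J(1) D_face_iff[of m E J] complex_of_iff[of J E m] by blast
  next
    \<comment> \<open>An apex is chosen in every degree, but only the degrees in which some
      \<open>z (J - {e})\<close> contributes can give a nonzero value.\<close>
    have "{m. W m J \<noteq> 0} \<subseteq> (\<Union>e\<in>J. Poly_Mapping.keys (monom (\<Sum>(J - {e})) * z (J - {e})))"
      using W_nonzero by (fastforce simp: degree_part_def in_keys_iff)
    then show "finite {m. W m J \<noteq> 0}"
      by (rule finite_subset) (use finite_subset[OF J(1) fin] in auto)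
  qed
  then have "\<forall>J. \<exists>f. J \<subseteq> E \<and> card J = Suc i \<longrightarrow>
      (\<forall>m. Poly_Mapping.lookup (monom (\<Sum>J) * f :: 's \<Rightarrow>\<^sub>0 'k) m = W m J)" by blast
  from choice[OF this] obtain w where
    w: "\<And>J m. J \<subseteq> E \<Longrightarrow> card J = Suc i \<Longrightarrow> degree_part m w J = W m J"
    unfolding degree_part_def by blast
  have "z J - K.boundary w J \<in> {0}" if J: "J \<subseteq> E" "card J = i" for J
  proof -
    have "z J = K.boundary w J"
    proof (rule eq_of_degree_part[of z J "K.boundary w"])
      fix m
      have "degree_part m (K.boundary w) J = C.boundary (W m) J"
        unfolding degree_part_boundary[OF J(1)]
        using w J by (intro C.boundary_cong) auto
      also have "\<dots> = degree_part m z J"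
      proof (cases "supp E m = {}")
        case True
        then have "J \<notin> complex_of E m"
          using face_subset_supp[OF fin, of J m] J \<open>0 < i\<close> by auto
        then show ?thesis
          using True degree_part_eq_0[OF J(1)] by (simp add: W_def C.boundary_def)
      next
        case False
        then have e: "apex m \<in> E" using apex[OF False] by (simp add: supp_def)
        have "C.cone (apex m) (C.boundary (degree_part m z)) J = 0"
        proof (cases "apex m \<in> J")
          case True
          then have "Suc (card (J - {apex m})) = i"
            using card_Suc_Diff1[OF finite_subset[OF J(1) fin]] J(2) by simp
          then have "C.boundary (degree_part m z) (J - {apex m}) = 0"
            using J(1) by (intro cyc) auto
          then show ?thesis by (simp add: C.cone_def)
        qed (simp add: C.cone_def)
        then show ?thesis
          using C.boundary_cone[OF J(1) e, of "degree_part m z"] False by (simp add: W_def)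
      qed
      finally show "degree_part m z J = degree_part m (K.boundary w) J" by simp
    qed
    then show ?thesis by simp
  qed
  then show "\<exists>w. \<forall>J\<subseteq>E. card J = i \<longrightarrow> z J - K.boundary w J \<in> {0}" by blast
qed

text \<open>The boundary of the missing face \<open>J0\<close> is a cycle of \<open>complex_of E m\<close>; it bounds nothing,
  for lack of faces of the dimension of \<open>J0\<close>.\<close>

lemma not_exact_of_missing_face:
  assumes J0: "J0 \<subseteq> E" "card J0 = Suc i"
    and faces: "\<And>e. e \<in> J0 \<Longrightarrow> J0 - {e} \<in> complex_of E m"
    and none: "\<And>J. J \<subseteq> E \<Longrightarrow> card J = Suc i \<Longrightarrow> J \<notin> complex_of E m"
  shows "\<not> exact {0} i"
proof
  assume ex: "exact {0} i"
  \<comment> \<open>The simplex \<open>J0\<close> itself, a chain of the full simplex whose boundary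
    is supported on faces of \<open>complex_of E m\<close>.\<close>
  define \<delta> :: "'s set \<Rightarrow> 'k" where "\<delta> J = (if J = J0 then 1 else 0)" for J
  define W where "W m' J = (if m' = m then C.boundary \<delta> J else 0)" for m' J
  have "\<exists>f. \<forall>m'. Poly_Mapping.lookup (monom (\<Sum>J) * f :: 's \<Rightarrow>\<^sub>0 'k) m' = W m' J"
    if J: "J \<subseteq> E" "card J = i" for J
  proof (rule exists_chain)
    fix m' assume "W m' J \<noteq> 0"
    then have "m' = m" and nz: "C.boundary \<delta> J \<noteq> 0" by (auto simp: W_def split: if_splits)
    have "\<exists>e\<in>E - J. insert e J = J0"
    proof (rule ccontr)
      assume "\<not> ?thesis"
      then have "C.boundary \<delta> J = 0"
        unfolding C.boundary_def by (intro sum.neutral) (auto simp: \<delta>_def)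
      with nz show False by simp
    qed
    then obtain e where e: "e \<in> E - J" "insert e J = J0" by blast
    then have "J = J0 - {e}" "e \<in> J0" by auto
    then show "J \<in> complex_of E m'" using faces \<open>m' = m\<close> by blast
  next
    have "{m'. W m' J \<noteq> 0} \<subseteq> {m}" by (auto simp: W_def)
    then show "finite {m'. W m' J \<noteq> 0}" by (rule finite_subset) simp
  qed
  then have "\<forall>J. \<exists>f. J \<subseteq> E \<and> card J = i \<longrightarrow>
      (\<forall>m'. Poly_Mapping.lookup (monom (\<Sum>J) * f :: 's \<Rightarrow>\<^sub>0 'k) m' = W m' J)" by blast
  from choice[OF this] obtain z where
    z: "\<And>J m'. J \<subseteq> E \<Longrightarrow> card J = i \<Longrightarrow> degree_part m' z J = W m' J"
    unfolding degree_part_def by blast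
  have "K.boundary z J \<in> {0}" if J: "J \<subseteq> E" "Suc (card J) = i" for J
  proof -
    have "K.boundary z J = (\<lambda>_. 0) J"
    proof (rule eq_of_degree_part[of "K.boundary z" J "\<lambda>_. 0"])
      fix m'
      have "degree_part m' (K.boundary z) J = C.boundary (W m') J"
        unfolding degree_part_boundary[OF J(1)]
        using z J by (intro C.boundary_cong) auto
      also have "\<dots> = 0"
      proof (cases "m' = m")
        case True
        then have "W m' = C.boundary \<delta>" by (auto simp: W_def)
        then show ?thesis using C.boundary_boundary[OF J(1)] by simp
      next
        case False
        then show ?thesis by (simp add: W_def C.boundary_def)
      qed
      finally show "degree_part m' (K.boundary z) J = degree_part m' (\<lambda>_. 0) J"
        by (simp add: degree_part_def)
    qed
    then show ?thesis by simp
  qed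
  then obtain w where w: "\<And>J. J \<subseteq> E \<Longrightarrow> card J = i \<Longrightarrow> z J - K.boundary w J \<in> {0}"
    using ex unfolding exact_def K.exact_def by blast
  obtain e where e: "e \<in> J0" using J0(2) by fastforce
  define J where "J = J0 - {e}"
  have finJ0: "finite J0" using J0(1) fin finite_subset by blast
  have J: "J \<subseteq> E" "card J = i" "e \<in> E - J" "insert e J = J0"
    using J0 e finJ0 by (auto simp: J_def)
  have "C.boundary \<delta> J = degree_part m z J" using z[OF J(1,2)] by (simp add: W_def)
  also have "\<dots> = degree_part m (K.boundary w) J"
    using w[OF J(1,2)] by (simp add: degree_part_def)
  also have "\<dots> = C.boundary (degree_part m w) J" by (rule degree_part_boundary[OF J(1)])
  \<comment> \<open>In degree \<open>m\<close> no set of size \<open>Suc i\<close> is a face, so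
    \<open>w\<close> has no part there, while the boundary of \<open>J0\<close> has coefficient 1 or
    -1 at \<open>J\<close>.\<close>
  also have "\<dots> = C.boundary (\<lambda>_. 0) J"
    using J none degree_part_eq_0 by (intro C.boundary_cong) auto
  also have "\<dots> = 0" by (simp add: C.boundary_def)
  finally have "C.boundary \<delta> J = 0" .
  moreover have "C.boundary \<delta> J = (\<Sum>a\<in>E - J. if a = e then koszul_sign idx e J else 0)"
    unfolding C.boundary_def
  proof (rule sum.cong)
    fix a assume "a \<in> E - J"
    then have "insert a J = J0 \<longleftrightarrow> a = e" using J by blast
    then show "koszul_sign idx a J * 1 * \<delta> (insert a J) = (if a = e then koszul_sign idx e J else 0)"
      by (auto simp: \<delta>_def)
  qed simp
  then have "C.boundary \<delta> J = koszul_sign idx e J" using J(3) fin by simp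
  ultimately show False by (simp add: koszul_sign_def)
qed

end

section \<open>Maximal elements of the sets of missing faces\<close>

lemma D_face_subset_D_set:
  assumes "finite E"
  shows "D_face E J \<subseteq> (D_set E :: 's set)"
proof
  fix m assume m: "m \<in> D_face E J"
  show "m \<in> D_set E"
  proof (rule ccontr)
    assume "m \<notin> D_set E"
    then have "supp E m \<in> complex_of E m"
      by (simp add: D_set_def complex_of_def supp_def)
    then have "J \<in> complex_of E m"
      using complex_of_subset[OF assms] m by (auto simp: D_face_iff)
    then show False using m by (simp add: D_face_iff complex_of_iff)
  qed
qed

text \<open>Counting divisors replaces a search for maximal elements. If \<open>m + e\<close> were
  in \<open>D_face E J\<close>, it would have all divisors of \<open>m\<close> and also itself,
  which by positivity does not divide \<open>m\<close>. As \<open>J\<close> still lies in its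
  support, \<open>m + e\<close> is divisible by \<open>e_J\<close>, and cancelling \<open>e\<close>
  makes \<open>J - {e}\<close> a face in degree \<open>m\<close>.\<close>

lemma exists_missing_face:
  assumes pos: "positive TYPE('s)" and "finite E" "0 \<notin> (E :: 's set)" "J \<subseteq> E"
    and "finite (D_face E J)" "D_face E J \<noteq> {}"
  shows "\<exists>m\<in>D_face E J. \<forall>e\<in>J. J - {e} \<in> complex_of E m"
proof -
  define divisors where "divisors m = {s \<in> D_face E J. \<exists>k. m = s + k}" for m
  have fin: "finite (divisors m)" for m
    unfolding divisors_def using assms(5) by simp
  let ?c = "(\<lambda>m. card (divisors m)) ` D_face E J"
  have "Max ?c \<in> ?c" using assms(5,6) by (intro Max_in) auto
  then obtain m where m: "m \<in> D_face E J" and "card (divisors m) = Max ?c" by auto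
  then have max: "card (divisors m') \<le> card (divisors m)" if "m' \<in> D_face E J" for m'
    using that assms(5) by simp
  have "J - {e} \<in> complex_of E m" if e: "e \<in> J" for e
  proof -
    have "m + e \<notin> D_face E J"
    proof
      assume me: "m + e \<in> D_face E J"
      have "divisors m \<subseteq> divisors (m + e)"
        unfolding divisors_def by (auto simp: add.assoc)
      moreover have "m + e \<in> divisors (m + e)"
        unfolding divisors_def using me by (auto intro: exI[of _ 0])
      moreover have "m + e \<notin> divisors m"
      proof
        assume "m + e \<in> divisors m"
        then obtain k where "m = m + e + k" unfolding divisors_def by blast
        then have "m + 0 = m + (e + k)" by (simp add: add.assoc)
        then have "e + k = 0" unfolding add_left_cancel_semigroup by simp
        then have "e = 0" using pos unfolding positive_def by blast
        with e assms(3,4) show False by blast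
      qed
      ultimately have "card (divisors m) < card (divisors (m + e))"
        by (intro psubset_card_mono[OF fin]) blast
      with max[OF me] show False by simp
    qed
    moreover have "J \<subseteq> supp E (m + e)"
    proof
      fix a assume "a \<in> J"
      then have "a \<in> supp E m" using m by (auto simp: D_face_iff)
      then obtain k where "a \<in> E" "m = a + k" by (auto simp: supp_iff)
      then show "a \<in> supp E (m + e)" by (auto simp: supp_iff add.assoc)
    qed
    ultimately obtain k where k: "m + e = \<Sum>J + k" by (auto simp: D_face_iff)
    have "\<Sum>J = e + \<Sum>(J - {e})"
      using sum.remove[OF finite_subset[OF assms(4,2)] e, of "\<lambda>x. x"] by simp
    then have "e + m = e + (\<Sum>(J - {e}) + k)" using k by (simp add: ac_simps)
    then have "m = \<Sum>(J - {e}) + k" unfolding add_left_cancel_semigroup .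
    then show ?thesis using assms(4) by (auto simp: complex_of_iff)
  qed
  then show ?thesis using m by blast
qed

text \<open>With at least two vertices, each vertex of \<open>J0\<close> lies in a proper face
  \<open>J0 - {a}\<close>, so \<open>J0\<close> is inside the support. A face \<open>J\<close> of
  the same size would make \<open>J0 \<union> J\<close> a larger subset of the support, hence a
  face, and then \<open>J0\<close> would be one.\<close>

lemma sphere_excludes_faces:
  assumes "finite E" and J0: "J0 \<subseteq> E" "J0 \<notin> complex_of E (m :: 's)"
    "\<And>e. e \<in> J0 \<Longrightarrow> J0 - {e} \<in> complex_of E m" and "2 \<le> card J0"
    and empty: "\<And>J. J \<subseteq> E \<Longrightarrow> card J0 < card J \<Longrightarrow> D_face E J = {}"
    and J: "J \<subseteq> E" "card J = card J0"
  shows "J \<notin> complex_of E m"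
proof
  assume "J \<in> complex_of E m"
  then have sub: "J \<subseteq> supp E m" by (rule face_subset_supp[OF assms(1)])
  have finJ0: "finite J0" using finite_subset[OF J0(1) assms(1)] .
  have "J0 \<subseteq> supp E m"
  proof
    fix e assume e: "e \<in> J0"
    have "\<not> J0 \<subseteq> {e}" using card_mono[of "{e}" J0] \<open>2 \<le> card J0\<close> by auto
    then obtain a where "a \<in> J0" "a \<noteq> e" by blast
    then show "e \<in> supp E m"
      using face_subset_supp[OF assms(1) J0(3)[of a]] e by blast
  qed
  with sub have "J0 \<union> J \<subseteq> supp E m" by blast
  have "J \<noteq> J0" using J0(2) \<open>J \<in> complex_of E m\<close> by blast
  then have "\<not> J \<subseteq> J0" using card_subset_eq[OF finJ0] J(2) by blast
  then have "J0 \<subset> J0 \<union> J" by blast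
  then have "card J0 < card (J0 \<union> J)"
    using finite_subset[OF J(1) assms(1)] finJ0 by (intro psubset_card_mono) auto
  then have "D_face E (J0 \<union> J) = {}" using J0(1) J(1) by (intro empty) auto
  then have "J0 \<union> J \<in> complex_of E m"
    using \<open>J0 \<union> J \<subseteq> supp E m\<close> J0(1) J(1) D_face_iff[of m E "J0 \<union> J"]
      complex_of_iff[of "J0 \<union> J" E m] by blast
  then have "J0 \<in> complex_of E m" using complex_of_subset[OF assms(1)] by blast
  with J0(2) show False by blast
qed

end

section \<open>Bounds for the depth and the comparison with \<open>r'\<close>\<close>

lemma depth_ge:
  "set fs \<subseteq> I \<Longrightarrow> regular_sequence act fs \<Longrightarrow> enat (length fs) \<le> depth act I"
  unfolding depth_def by (intro SUP_upper) simp

lemma depth_le: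
  "(\<And>fs. set fs \<subseteq> I \<Longrightarrow> regular_sequence act fs \<Longrightarrow> length fs \<le> n) \<Longrightarrow> depth act I \<le> enat n"
  unfolding depth_def by (intro SUP_least) simp

theorem theorem5p3:
  fixes E :: "'s::comm_monoid_add set" and r :: enat and r' :: int
  assumes "finitely_generated TYPE('s)" and "positive TYPE('s)" and "cancelative TYPE('s)"
    and "finite E" and "E \<noteq> {}" and "E \<subseteq> UNIV - {0}" and "generates_cone E"
    and "r = semigroup_algebra_depth TYPE('k::field) E"
    and "is_r_prime E r'"
  shows "r \<ge> enat (nat r') \<and>
         ((\<exists>m J. is_sphere E (complex_of E m) (int (card E) - r' - 1) J) \<longrightarrow> enat (nat r') = r) \<and>
         (finite (D_set E) \<longrightarrow> enat (nat r') = r)"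
proof -
  note canc = assms(3) and fin = assms(4)
  have zero: "0 \<notin> E" using assms(6) by blast
  obtain idx :: "'s \<Rightarrow> nat" where inj: "inj_on idx E"
    using finite_imp_inj_to_nat_seg[OF fin] by blast
  let ?exact = "koszul.exact E idx (\<lambda>e. monom e :: 's \<Rightarrow>\<^sub>0 'k)"
  have bounds: "1 \<le> r'" "r' \<le> int (card E)"
    using is_r_prime_bounds[OF fin assms(5,9)] by auto
  \<comment> \<open>The index where homology has to be found for equality. The bounds on
    \<open>r'\<close> make the natural subtraction exact, and sets of size \<open>Suc i\<close> are
    those in the definition of \<open>r'\<close>.\<close>
  define i where "i = card E - nat r'"
  have i: "int i = int (card E) - r'" "nat r' + i = card E"
    using bounds by (auto simp: i_def)
  have empty: "D_face E J = {}" if J: "J \<subseteq> E" "Suc i < card J" for J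
  proof (cases "\<forall>J\<subseteq>E. card J \<ge> 2 \<longrightarrow> D_face E J = {}")
    case True
    then show ?thesis using J by auto
  next
    case False
    then have "\<forall>J\<subseteq>E. card J \<ge> 2 \<longrightarrow> int (card J) \<ge> int (card E) - r' + 2 \<longrightarrow> D_face E J = {}"
      using assms(9) unfolding is_r_prime_def if_not_P[OF False] by (elim conjE)
    moreover have "card J \<ge> 2" "int (card J) \<ge> int (card E) - r' + 2" using J i by linarith+
    ultimately show ?thesis using J by blast
  qed
  have ge: "enat (nat r') \<le> r"
  proof -
    have "?exact {0} j" if "card E < j + nat r'" for j
    proof (rule exact_zero[OF canc fin inj])
      show "0 < j" using that bounds by linarith
      show "D_face E J = {}" if "J \<subseteq> E" "card J = Suc j" for J
        using that \<open>card E < j + nat r'\<close> i by (intro empty) auto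
    qed
    then obtain fs where "length fs = nat r'"
      "set fs \<subseteq> (variable_ideal E :: (('s \<Rightarrow>\<^sub>0 nat) \<Rightarrow>\<^sub>0 'k) set)" "regular_sequence poly_act fs"
      using exists_regular_sequence[OF fin inj noetherian_semigroup_algebra[OF assms(1)] assms(2) zero]
        bounds by (metis nat_le_iff)
    then show ?thesis
      unfolding assms(8) semigroup_algebra_depth_def using depth_ge by metis
  qed
  have eqI: "enat (nat r') = r" if "\<not> ?exact {0} i"
  proof -
    have "r \<le> enat (nat r')"
      unfolding assms(8) semigroup_algebra_depth_def
    proof (rule depth_le)
      fix fs assume "set fs \<subseteq> (variable_ideal E :: (('s \<Rightarrow>\<^sub>0 nat) \<Rightarrow>\<^sub>0 'k) set)"
        "regular_sequence poly_act fs"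
      from length_regular_sequence_le[OF fin inj this(2,1) that] show "length fs \<le> nat r'"
        using i by linarith
    qed
    with ge show ?thesis by (rule antisym)
  qed
  have missing: "enat (nat r') = r"
    if J: "J \<subseteq> E" "card J = Suc i" "J \<notin> complex_of E m"
      "\<And>e. e \<in> J \<Longrightarrow> J - {e} \<in> complex_of E m" and "0 < i" for J m
  proof (rule eqI, rule not_exact_of_missing_face[OF canc fin inj J(1,2,4)])
    fix J' assume "J' \<subseteq> E" "card J' = Suc i"
    then show "J' \<notin> complex_of E m"
      using J \<open>0 < i\<close> empty by (intro sphere_excludes_faces[OF canc fin J(1,3,4)]) auto
  qed
  \<comment> \<open>A single vertex is too small for the argument with supports. In degree 0
    positivity leaves only the empty face, so any \<open>{e}\<close> is a missing face and no other
    face has its size.\<close>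
  have full: "enat (nat r') = r" if "i = 0"
  proof -
    obtain e where e: "e \<in> E" using assms(5) by blast
    have "J \<notin> complex_of E 0" if J: "J \<subseteq> E" "card J = Suc i" for J
    proof
      assume "J \<in> complex_of E 0"
      moreover obtain a where a: "a \<in> J" using J(2) by fastforce
      ultimately have "a \<in> supp E 0" using face_subset_supp[OF canc fin] by blast
      then obtain k where "0 = a + k" by (auto simp: supp_iff[OF canc])
      then have "a = 0" using assms(2) unfolding positive_def by metis
      then show False using a J(1) zero by blast
    qed
    moreover have "{} \<in> complex_of E 0" by (simp add: complex_of_iff[OF canc])
    ultimately show ?thesis
      using e \<open>i = 0\<close> by (intro eqI not_exact_of_missing_face[OF canc fin inj, of "{e}" i 0]) auto
  qed
  have sphere: "enat (nat r') = r"
    if "is_sphere E (complex_of E m) (int (card E) - r' - 1) J" for m J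
  proof (cases "i = 0")
    case False
    \<comment> \<open>Dimension \<open>#E - r' - 1\<close> is \<open>i - 1\<close>, so the sphere
      has \<open>Suc i\<close> vertices.\<close>
    show ?thesis
      using that False i unfolding is_sphere_def by (intro missing[of J m]) auto
  qed (rule full)
  have finite_D: "enat (nat r') = r" if "finite (D_set E)"
  proof (cases "i = 0")
    case False
    \<comment> \<open>A positive \<open>i\<close> rules out the convention \<open>r' = #E\<close>,
      so a nonempty \<open>D_face E J\<close> of the critical size exists.\<close>
    have neq: "\<not> (\<forall>J\<subseteq>E. card J \<ge> 2 \<longrightarrow> D_face E J = {})"
    proof
      assume "\<forall>J\<subseteq>E. card J \<ge> 2 \<longrightarrow> D_face E J = {}"
      then have "r' = int (card E)"
        using assms(9) unfolding is_r_prime_def by (simp only: if_True simp_thms)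
      with False i show False by simp
    qed
    have "\<exists>J\<subseteq>E. card J \<ge> 2 \<and> int (card J) = int (card E) - r' + 1 \<and> D_face E J \<noteq> {}"
      using assms(9) unfolding is_r_prime_def if_not_P[OF neq] by (elim conjE)
    then obtain J where J: "J \<subseteq> E" "D_face E J \<noteq> {}"
      and card_J: "int (card J) = int (card E) - r' + 1"
      by blast
    have "card J = Suc i" using card_J i(1) by linarith
    have "finite (D_face E J)"
      using D_face_subset_D_set[OF canc fin] that by (rule finite_subset)
    then obtain m where "m \<in> D_face E J" "\<forall>e\<in>J. J - {e} \<in> complex_of E m"
      using exists_missing_face[OF canc assms(2) fin zero J(1) _ J(2)] by blast
    then show ?thesis
      using J(1) \<open>card J = Suc i\<close> False by (intro missing[of J m]) (auto simp: D_face_iff[OF canc] complex_of_iff[OF canc])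
  qed (rule full)
  show ?thesis using ge sphere finite_D by blast
qed

end
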